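(* Let $X = (X_i)_{1 \le i \le n}$ be a centred Gaussian vector with covariance $K(i,j) = \mathbb{E}[X_i X_j]$, and suppose that $\mathrm{Corr}(X_i, X_j) < 1$ for all $1 \le i,j \le n$ with $i \neq j$. Let $M = \max_{1 \le i \le n} X_i$, let $I \in \{1,\ldots,n\}$ be the (almost surely unique) index such that $X_I = M$, and let $Q_1(M)$ be the best linear approximation of $M$ (the $L^2$-projection of $M - \mathbb{E}[M]$ onto the linear span of $X_1,\ldots,X_n$). Then $$ Q_1(M) = \sum_{1 \le i \le n} \mathbb{P}[I = i]\, X_i . $$ In particular $$ \mathrm{Var}\big[Q_1(M)\big] = \sum_{1 \le i,j \le n} K(i,j)\, \mathbb{P}[I=i]\, \mathbb{P}[I=j] . $$
   Context: Let $\mathcal{L}$ be the linear span of $X$, i.e. the set of random variables $Y = \sum_{1 \le i \le n} \alpha_i X_i$ with $\alpha_i \in \mathbb{R}$. $Q_1(M)$ denotes the $L^2$-projection of $M - \mathbb{E}[M]$ onto $\mathcal{L}$; equivalently, $Q_1(M)$ is the element of $\mathcal{L}$ that minimises $\mathbb{E}[(M - \mathbb{E}[M] - Q_1(M))^2]$. The maximum $M$ belongs to $L^2$, and the correlation assumption guarantees that the index $I$ is almost surely unique. Equality of random variables is almost sure. *)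

theory Defs
  imports "HOL-Probability.Probability"
begin

(* The library's normal_density requires a positive standard deviation, so the Dirac
   masses, which count as (degenerate) Gaussian laws, form the second disjunct. *)
definition gaussian_variable :: "'a measure \<Rightarrow> ('a \<Rightarrow> real) \<Rightarrow> bool" where
  "gaussian_variable \<Omega> Y \<longleftrightarrow>
     Y \<in> borel_measurable \<Omega> \<and>
     ((\<exists>\<mu> \<sigma>. \<sigma> > 0 \<and> distributed \<Omega> lborel Y (normal_density \<mu> \<sigma>)) \<or>
      (\<exists>c. AE \<omega> in \<Omega>. Y \<omega> = c))"

(* The variables themselves are kept rather than their almost-sure classes. *)
definition linear_span :: "nat \<Rightarrow> (nat \<Rightarrow> 'a \<Rightarrow> real) \<Rightarrow> ('a \<Rightarrow> real) set" where
  "linear_span n X = {\<lambda>\<omega>. \<Sum>i=1..n. \<alpha> i * X i \<omega> | \<alpha> :: nat \<Rightarrow> real. True}"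

(* Joint normality only: the covariance matrix may be singular. *)
definition centred_gaussian_vector :: "'a measure \<Rightarrow> nat \<Rightarrow> (nat \<Rightarrow> 'a \<Rightarrow> real) \<Rightarrow> bool" where
  "centred_gaussian_vector \<Omega> n X \<longleftrightarrow>
     (\<forall>Y\<in>linear_span n X. gaussian_variable \<Omega> Y) \<and>
     (\<forall>i\<in>{1..n}. prob_space.expectation \<Omega> (X i) = 0)"

definition covariance :: "'a measure \<Rightarrow> ('a \<Rightarrow> real) \<Rightarrow> ('a \<Rightarrow> real) \<Rightarrow> real" where
  "covariance \<Omega> Y Z =
     prob_space.expectation \<Omega> (\<lambda>\<omega>.
       (Y \<omega> - prob_space.expectation \<Omega> Y) * (Z \<omega> - prob_space.expectation \<Omega> Z))"

(* Only meaningful if both variances are positive; otherwise it is 0, since x / 0 = 0. *)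
definition correlation :: "'a measure \<Rightarrow> ('a \<Rightarrow> real) \<Rightarrow> ('a \<Rightarrow> real) \<Rightarrow> real" where
  "correlation \<Omega> Y Z =
     covariance \<Omega> Y Z / sqrt (prob_space.variance \<Omega> Y * prob_space.variance \<Omega> Z)"

definition square_integrable :: "'a measure \<Rightarrow> ('a \<Rightarrow> real) \<Rightarrow> bool" where
  "square_integrable \<Omega> Y \<longleftrightarrow> Y \<in> borel_measurable \<Omega> \<and> integrable \<Omega> (\<lambda>\<omega>. (Y \<omega>)\<^sup>2)"

(* Q is a version of the L2-projection of Y - E[Y] onto the span of X_1, ..., X_n.
   Square-integrability of Y is required because the Bochner integral of a
   non-integrable function is 0, which would make the comparison meaningless. *)
definition is_best_linear_approx ::
    "'a measure \<Rightarrow> nat \<Rightarrow> (nat \<Rightarrow> 'a \<Rightarrow> real) \<Rightarrow> ('a \<Rightarrow> real) \<Rightarrow> ('a \<Rightarrow> real) \<Rightarrow> bool" where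
  "is_best_linear_approx \<Omega> n X Y Q \<longleftrightarrow>
     square_integrable \<Omega> Y \<and>
     (\<forall>R\<in>linear_span n X. square_integrable \<Omega> R) \<and>
     Q \<in> linear_span n X \<and>
     (\<forall>R\<in>linear_span n X.
        prob_space.expectation \<Omega> (\<lambda>\<omega>. (Y \<omega> - prob_space.expectation \<Omega> Y - Q \<omega>)\<^sup>2)
        \<le> prob_space.expectation \<Omega> (\<lambda>\<omega>. (Y \<omega> - prob_space.expectation \<Omega> Y - R \<omega>)\<^sup>2))"

end

theory Submission
  imports Defs
begin

text \<open>
  The projection is characterised by orthogonality, so everything reduces to the identity
  E[M X_j] = sum_i P[I = i] K(i, j). Let Z = X_j have variance s > 0, and write X_i = a_i Z + W_i with
  a_i = K(i, j) / s. The vector W is uncorrelated with Z, hence independent of it: the characteristic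
  function factorises, and Levy's uniqueness theorem is applied to one coordinate at a time.
  Shifting Z by t is then the same as tilting the measure by exp (t Z / s - t^2 / (2 s)), so
  E[max_i (X_i + t a_i)] = E[M exp (t Z / s - t^2 / (2 s))]. The left-hand side is at least
  E[M] + t E[a_I] for t of either sign, and differentiating the right-hand side at t = 0 gives
  E[M Z] / s = E[a_I].
\<close>

section \<open>Independence from factorisation of the characteristic function\<close>

text \<open>The covariance matrix may be singular, so the vector need not have a density:
  independence has to come from characteristic functions rather than from a product of densities.
  The identity to be shown is formally Gaussian integration by parts, E[f(X) X_j] = sum_i K(i, j)
  E[d_i f(X)], for f = max, because the gradient of the maximum at X is the unit vector of the index
  I. The maximum is not smooth, and convexity takes the place of smoothness: as a function of t,
  E[max_i (X_i + t a_i)] lies above a line of slope E[a_I] and touches it at t = 0, so if it is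
  differentiable there, its derivative is that slope. Differentiability becomes visible after the
  change of measure, which moves t out of the maximum into a smooth exponential factor. That factor
  is the ratio of the normal densities of variance s with means t and 0. The a_i are the regression
  coefficients of X_i on Z: they make W uncorrelated with Z, and moving Z by t with W held fixed
  moves X_i by t a_i.\<close>

text \<open>The image under \<open>Y\<close> of the signed measure with density \<open>h\<close> has
  zero Fourier transform, so it vanishes on every Borel set. Levy's theorem speaks of probability
  laws only, hence the comparison of the law of \<open>Y\<close> under a perturbed measure with its
  law under \<open>M\<close>.\<close>

lemma (in prob_space) expectation_indicator_eq_0_of_char_real:
  fixes h :: "'a \<Rightarrow> real"
  assumes [measurable]: "Y \<in> borel_measurable M" "h \<in> borel_measurable M"
    and bounded: "\<And>\<omega>. \<bar>h \<omega>\<bar> \<le> C"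
    and char0: "\<And>s. (CLINT \<omega>|M. iexp (s * Y \<omega>) * of_real (h \<omega>)) = 0"
    and [measurable]: "B \<in> sets borel"
  shows "expectation (\<lambda>\<omega>. indicator B (Y \<omega>) * h \<omega>) = 0"
proof -
  \<comment> \<open>Adding a constant makes the weight nonnegative, so that Levy's uniqueness theorem applies.\<close>
  define D where "D = \<bar>C\<bar> + 1"
  have D: "D > 0" and hD: "\<bar>h \<omega>\<bar> \<le> D" for \<omega>
    using bounded[of \<omega>] by (auto simp: D_def)
  define w where "w \<omega> = 1 + h \<omega> / D" for \<omega>
  have w_meas[measurable]: "w \<in> borel_measurable M" unfolding w_def by simp
  have w0: "0 \<le> w \<omega>" for \<omega> using hD[of \<omega>] D by (auto simp: w_def field_simps)
  have hint: "integrable M h"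
    by (rule integrable_const_bound[of _ D]) (use hD in auto)
  have wint: "integrable M w" unfolding w_def using hint by simp
  \<comment> \<open>Frequency 0 of the hypothesis: it gives \<open>w\<close> mean 1, so that
    \<open>density M w\<close> is again a probability measure.\<close>
  have h_int0: "expectation h = 0"
    using char0[of 0] by simp
  have w1: "expectation w = 1"
    unfolding w_def using hint h_int0 by (simp add: prob_space)
  interpret W: prob_space "density M w"
    using w1 w0 wint by (intro prob_spaceI) (simp add: emeasure_density nn_integral_eq_integral)
  let ?M1 = "distr (density M w) borel Y" and ?M2 = "distr M borel Y"
  interpret M1: real_distribution ?M1 by (rule W.real_distribution_distr) simp
  interpret M2: real_distribution ?M2 by simp
  have iexp_int: "integrable M (\<lambda>\<omega>. iexp (t * Y \<omega>))" for t
    by (rule integrable_const_bound[of _ 1]) auto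
  have iexp_h_int: "integrable M (\<lambda>\<omega>. iexp (t * Y \<omega>) * of_real (h \<omega>))" for t
    by (rule integrable_const_bound[of _ D]) (use hD in \<open>auto simp: norm_mult\<close>)
  have "char ?M1 t = char ?M2 t" for t
  proof -
    have "char ?M1 t = (CLINT \<omega>|M. w \<omega> *\<^sub>R iexp (t * Y \<omega>))"
      unfolding char_def by (simp add: integral_distr integral_density w0)
    also have "\<dots> = (CLINT \<omega>|M. iexp (t * Y \<omega>) + (iexp (t * Y \<omega>) * of_real (h \<omega>)) / of_real D)"
      by (intro Bochner_Integration.integral_cong) (auto simp: w_def scaleR_conv_of_real algebra_simps)
    also have "\<dots> = (CLINT \<omega>|M. iexp (t * Y \<omega>))"
      by (subst Bochner_Integration.integral_add)
         (use iexp_int iexp_h_int char0 in \<open>auto\<close>)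
    also have "\<dots> = char ?M2 t"
      unfolding char_def by (simp add: integral_distr)
    finally show ?thesis .
  qed
  then have "?M1 = ?M2"
    by (intro Levy_uniqueness M1.real_distribution_axioms M2.real_distribution_axioms) auto
  moreover have "integral\<^sup>L ?M1 (indicator B :: real \<Rightarrow> real) = expectation (\<lambda>\<omega>. w \<omega> * indicator B (Y \<omega>))"
    by (subst integral_distr, simp, simp, subst integral_density) (auto simp: w0)
  moreover have "integral\<^sup>L ?M2 (indicator B :: real \<Rightarrow> real) = expectation (\<lambda>\<omega>. indicator B (Y \<omega>))"
    by (subst integral_distr) auto
  ultimately have "expectation (\<lambda>\<omega>. w \<omega> * indicator B (Y \<omega>)) = expectation (\<lambda>\<omega>. indicator B (Y \<omega>))"
    by metis
  moreover have "expectation (\<lambda>\<omega>. w \<omega> * indicator B (Y \<omega>)) =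
      expectation (\<lambda>\<omega>. indicator B (Y \<omega>) + (indicator B (Y \<omega>) * h \<omega>) / D)"
    by (intro Bochner_Integration.integral_cong) (auto simp: w_def algebra_simps)
  moreover have "\<dots> = expectation (\<lambda>\<omega>. indicator B (Y \<omega>)) + expectation (\<lambda>\<omega>. indicator B (Y \<omega>) * h \<omega>) / D"
  proof (subst Bochner_Integration.integral_add)
    show "integrable M (\<lambda>\<omega>. indicator B (Y \<omega>) :: real)"
      by (rule integrable_const_bound[of _ 1]) (auto simp: indicator_def)
    have "integrable M (\<lambda>\<omega>. indicator B (Y \<omega>) * h \<omega>)"
      by (rule integrable_const_bound[of _ D]) (use hD D in \<open>auto simp: indicator_def\<close>)
    then show "integrable M (\<lambda>\<omega>. indicator B (Y \<omega>) * h \<omega> / D)" by simp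
  qed simp
  ultimately show ?thesis using D by simp
qed

text \<open>The weights met in the coordinatewise argument contain factors \<open>iexp\<close>, so
  they are complex. Real and imaginary parts are combinations of \<open>h\<close> and
  \<open>cnj h\<close>, and each is a real weight with vanishing transform.\<close>

lemma (in prob_space) expectation_indicator_eq_0_of_char:
  fixes h :: "'a \<Rightarrow> complex"
  assumes Y[measurable]: "Y \<in> borel_measurable M" and [measurable]: "h \<in> borel_measurable M"
    and bounded: "\<And>\<omega>. cmod (h \<omega>) \<le> C"
    and char0: "\<And>s. (CLINT \<omega>|M. iexp (s * Y \<omega>) * h \<omega>) = 0"
    and B: "B \<in> sets borel"
  shows "(CLINT \<omega>|M. indicator B (Y \<omega>) * h \<omega>) = 0"
proof -
  note [measurable] = B
  have [measurable]: "cnj \<in> borel_measurable borel"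
    by (intro borel_measurable_continuous_onI continuous_intros)
  have int: "integrable M (\<lambda>\<omega>. iexp (s * Y \<omega>) * h \<omega>)"
       "integrable M (\<lambda>\<omega>. iexp (s * Y \<omega>) * cnj (h \<omega>))" for s
    by (rule integrable_const_bound[of _ C]; use bounded in \<open>auto simp: norm_mult\<close>)+
  \<comment> \<open>Conjugation reverses the frequency, which is harmless because the hypothesis
    covers \<open>- s\<close> too.\<close>
  have cnj0: "(CLINT \<omega>|M. iexp (s * Y \<omega>) * cnj (h \<omega>)) = 0" for s
  proof -
    have "(CLINT \<omega>|M. iexp (s * Y \<omega>) * cnj (h \<omega>)) = cnj (CLINT \<omega>|M. iexp ((-s) * Y \<omega>) * h \<omega>)"
      by (subst integral_bounded_linear[OF bounded_linear_cnj int(1), symmetric])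
         (simp add: exp_cnj)
    then show ?thesis using char0[of "- s"] by simp
  qed
  have re: "expectation (\<lambda>\<omega>. indicator B (Y \<omega>) * Re (h \<omega>)) = 0"
  proof (rule expectation_indicator_eq_0_of_char_real[OF Y _ _ _ B])
    show "\<bar>Re (h \<omega>)\<bar> \<le> C" for \<omega> using abs_Re_le_cmod bounded order_trans by blast
    have eq: "(CLINT \<omega>|M. iexp (s * Y \<omega>) * complex_of_real (Re (h \<omega>))) =
       (CLINT \<omega>|M. (iexp (s * Y \<omega>) * h \<omega> + iexp (s * Y \<omega>) * cnj (h \<omega>)) / 2)" for s
      by (intro Bochner_Integration.integral_cong) (auto simp: distrib_left[symmetric] complex_add_cnj)
    show "(CLINT \<omega>|M. iexp (s * Y \<omega>) * complex_of_real (Re (h \<omega>))) = 0" for s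
      by (subst eq) (use int[of s] char0[of s] cnj0[of s] in simp)
  qed simp
  have im: "expectation (\<lambda>\<omega>. indicator B (Y \<omega>) * Im (h \<omega>)) = 0"
  proof (rule expectation_indicator_eq_0_of_char_real[OF Y _ _ _ B])
    show "\<bar>Im (h \<omega>)\<bar> \<le> C" for \<omega> using abs_Im_le_cmod bounded order_trans by blast
    have im_eq: "complex_of_real (Im (h \<omega>)) = (h \<omega> - cnj (h \<omega>)) / (2 * \<i>)" for \<omega>
      by (subst nonzero_eq_divide_eq) (simp_all add: complex_diff_cnj mult_ac)
    have eq: "(CLINT \<omega>|M. iexp (s * Y \<omega>) * complex_of_real (Im (h \<omega>))) =
       (CLINT \<omega>|M. (iexp (s * Y \<omega>) * h \<omega> - iexp (s * Y \<omega>) * cnj (h \<omega>)) / (2 * \<i>))" for s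
      by (intro Bochner_Integration.integral_cong) (simp_all add: im_eq algebra_simps diff_divide_distrib)
    show "(CLINT \<omega>|M. iexp (s * Y \<omega>) * complex_of_real (Im (h \<omega>))) = 0" for s
      by (subst eq) (use int[of s] char0[of s] cnj0[of s] in simp)
  qed simp
  have ib: "integrable M (\<lambda>\<omega>. indicator B (Y \<omega>) * h \<omega>)"
  proof (rule integrable_const_bound[of _ C])
    show "AE \<omega> in M. cmod (indicator B (Y \<omega>) * h \<omega>) \<le> C"
      using bounded order_trans[OF norm_ge_zero bounded] by (auto simp: indicator_def)
  qed simp
  show ?thesis
  proof (rule complex_eqI)
    show "Re (CLINT \<omega>|M. indicator B (Y \<omega>) * h \<omega>) = Re 0"
      using re integral_bounded_linear[OF bounded_linear_Re ib]
      by (simp add: indicator_def of_bool_def if_distrib if_distribR cong: if_cong)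
    show "Im (CLINT \<omega>|M. indicator B (Y \<omega>) * h \<omega>) = Im 0"
      using im integral_bounded_linear[OF bounded_linear_Im ib]
      by (simp add: indicator_def of_bool_def if_distrib if_distribR cong: if_cong)
  qed
qed

text \<open>Factorisation says that the bounded weight \<open>iexp (s * Z \<omega>) - c s\<close> is
  orthogonal to all exponentials of linear combinations of the \<open>W k\<close>. The
  one-dimensional uniqueness lemma turns these exponentials into indicators of boxes, and then, with
  \<open>Z\<close> in the role of the variable, turns the remaining frequency \<open>s\<close> into
  a Borel set.\<close>

lemma (in prob_space) distr_Pair_eq_of_char_factors:
  fixes Z :: "'a \<Rightarrow> real" and W :: "'i \<Rightarrow> 'a \<Rightarrow> real"
  assumes Z[measurable]: "Z \<in> borel_measurable M"
    and W: "\<And>k. k \<in> J \<Longrightarrow> W k \<in> borel_measurable M"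
    and J: "finite J"
    and factors: "\<And>s t. (CLINT \<omega>|M. iexp (s * Z \<omega> + (\<Sum>k\<in>J. t k * W k \<omega>))) =
      (CLINT \<omega>|M. iexp (s * Z \<omega>)) * (CLINT \<omega>|M. iexp (\<Sum>k\<in>J. t k * W k \<omega>))"
  shows "distr M (borel \<Otimes>\<^sub>M Pi\<^sub>M J (\<lambda>_. borel)) (\<lambda>\<omega>. (Z \<omega>, \<lambda>k\<in>J. W k \<omega>)) =
    distr M borel Z \<Otimes>\<^sub>M distr M (Pi\<^sub>M J (\<lambda>_. borel)) (\<lambda>\<omega>. \<lambda>k\<in>J. W k \<omega>)"
proof -
  have W'[measurable]: "(\<lambda>\<omega>. \<lambda>k\<in>J. W k \<omega>) \<in> measurable M (Pi\<^sub>M J (\<lambda>_. borel))"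
    using W by (intro measurable_restrict) auto
  define c where "c s = (CLINT \<omega>|M. iexp (s * Z \<omega>))" for s
  have c_int: "integrable M (\<lambda>\<omega>. iexp (s * Z \<omega>))" for s
    by (rule integrable_const_bound[of _ 1]) auto
  have c1: "cmod (c s) \<le> 1" for s
  proof -
    have "cmod (c s) \<le> expectation (\<lambda>\<omega>. cmod (iexp (s * Z \<omega>)))"
      unfolding c_def by (rule integral_norm_bound)
    then show ?thesis by (simp add: prob_space)
  qed
  have bnd: "cmod (iexp (s * Z \<omega>) - c s) \<le> 2" for s \<omega>
    using norm_triangle_ineq4[of "iexp (s * Z \<omega>)" "c s"] c1[of s] by simp
  have prod_ind: "cmod (\<Prod>k\<in>L. indicator (B k) (W k \<omega>)) \<le> 1" for L B \<omega>
    unfolding prod_norm[symmetric] by (intro prod_le_1) (auto simp: indicator_def)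

  \<comment> \<open>The frequencies of the coordinates in L are traded for Borel sets one coordinate at a time.\<close>
  have step: "(CLINT \<omega>|M. (iexp (s * Z \<omega>) - c s) * (\<Prod>k\<in>L. indicator (B k) (W k \<omega>)) *
        iexp (\<Sum>k\<in>J - L. t k * W k \<omega>)) = 0"
    if "finite L" "L \<subseteq> J" "\<And>k. k \<in> L \<Longrightarrow> B k \<in> sets borel" for L B s t
    using that
  proof (induction L arbitrary: t)
    case empty
    have [measurable]: "(\<lambda>\<omega>. \<Sum>k\<in>J. t k * W k \<omega>) \<in> borel_measurable M"
      using W by (intro borel_measurable_sum borel_measurable_times) auto
    have i: "integrable M (\<lambda>\<omega>. iexp (s * Z \<omega> + (\<Sum>k\<in>J. t k * W k \<omega>)))"
         "integrable M (\<lambda>\<omega>. iexp (\<Sum>k\<in>J. t k * W k \<omega>))"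
      by (rule integrable_const_bound[of _ 1]; simp del: of_real_add of_real_sum)+
    have "(CLINT \<omega>|M. (iexp (s * Z \<omega>) - c s) * (\<Prod>k\<in>{}. indicator (B k) (W k \<omega>)) *
        iexp (\<Sum>k\<in>J - {}. t k * W k \<omega>)) =
      (CLINT \<omega>|M. iexp (s * Z \<omega> + (\<Sum>k\<in>J. t k * W k \<omega>)) - c s * iexp (\<Sum>k\<in>J. t k * W k \<omega>))"
      by (intro Bochner_Integration.integral_cong)
        (simp_all add: left_diff_distrib exp_add distrib_left)
    also have "\<dots> = 0"
      using i factors[of s t] by (simp add: c_def del: of_real_add of_real_sum)
    finally show ?case .
  next
    case (insert l L)
    then have l: "l \<in> J" "l \<notin> L" "L \<subseteq> J" and B: "\<And>k. k \<in> insert l L \<Longrightarrow> B k \<in> sets borel"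
      by auto
    define h where "h \<omega> = (iexp (s * Z \<omega>) - c s) * (\<Prod>k\<in>L. indicator (B k) (W k \<omega>)) *
        iexp (\<Sum>k\<in>J - insert l L. t k * W k \<omega>)" for \<omega>
    have [measurable]: "W l \<in> borel_measurable M" using W l by simp
    have [measurable]: "(\<lambda>\<omega>. \<Prod>k\<in>L. indicator (B k) (W k \<omega>) :: complex) \<in> borel_measurable M"
      using W B l by (intro borel_measurable_prod) (auto intro!: borel_measurable_indicator' )
    have [measurable]: "(\<lambda>\<omega>. \<Sum>k\<in>J - insert l L. t k * W k \<omega>) \<in> borel_measurable M"
      using W by (intro borel_measurable_sum borel_measurable_times) auto
    have "(CLINT \<omega>|M. indicator (B l) (W l \<omega>) * h \<omega>) = 0"
    proof (rule expectation_indicator_eq_0_of_char)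
      show "h \<in> borel_measurable M" unfolding h_def by measurable
      have "cmod (h \<omega>) \<le> 2 * 1 * 1" for \<omega>
        unfolding h_def norm_mult
        by (intro mult_mono bnd prod_ind) (simp_all del: of_real_sum)
      then show "cmod (h \<omega>) \<le> 2" for \<omega> by simp
      \<comment> \<open>A frequency \<open>r\<close> on \<open>W l\<close> is the same as the entry
        \<open>r\<close> at \<open>l\<close> in the frequency vector, so this is the induction
        hypothesis for \<open>t(l := r)\<close>. This is why the induction generalises over
        \<open>t\<close>.\<close>
      show "(CLINT \<omega>|M. iexp (r * W l \<omega>) * h \<omega>) = 0" for r
      proof -
        have "(CLINT \<omega>|M. iexp (r * W l \<omega>) * h \<omega>) =
          (CLINT \<omega>|M. (iexp (s * Z \<omega>) - c s) * (\<Prod>k\<in>L. indicator (B k) (W k \<omega>)) *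
            iexp (\<Sum>k\<in>J - L. (t(l := r)) k * W k \<omega>))"
        proof (intro Bochner_Integration.integral_cong refl)
          fix \<omega>
          have JL: "J - L = insert l (J - insert l L)" using l by auto
          have "(\<Sum>k\<in>J - L. (t(l := r)) k * W k \<omega>) =
              r * W l \<omega> + (\<Sum>k\<in>J - insert l L. (t(l := r)) k * W k \<omega>)"
            unfolding JL using J by (subst sum.insert) auto
          also have "(\<Sum>k\<in>J - insert l L. (t(l := r)) k * W k \<omega>) = (\<Sum>k\<in>J - insert l L. t k * W k \<omega>)"
            by (intro sum.cong) auto
          finally show "iexp (r * W l \<omega>) * h \<omega> =
              (iexp (s * Z \<omega>) - c s) * (\<Prod>k\<in>L. indicator (B k) (W k \<omega>)) *
              iexp (\<Sum>k\<in>J - L. (t(l := r)) k * W k \<omega>)"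
            by (simp add: h_def exp_add distrib_left del: of_real_sum fun_upd_apply)
        qed
        also have "\<dots> = 0" using insert.IH[of "t(l := r)"] l B by auto
        finally show ?thesis .
      qed
    qed (use W l B in auto)
    also have "(\<lambda>\<omega>. indicator (B l) (W l \<omega>) * h \<omega>) = (\<lambda>\<omega>. (iexp (s * Z \<omega>) - c s) *
        (\<Prod>k\<in>insert l L. indicator (B k) (W k \<omega>)) * iexp (\<Sum>k\<in>J - insert l L. t k * W k \<omega>))"
      using insert.hyps by (simp add: h_def mult_ac fun_eq_iff)
    finally show ?case .
  qed

  have box: "prob (Z -` A \<inter> (\<lambda>\<omega>. \<lambda>k\<in>J. W k \<omega>) -` (Pi\<^sub>E J B) \<inter> space M) =
      prob (Z -` A \<inter> space M) * prob ((\<lambda>\<omega>. \<lambda>k\<in>J. W k \<omega>) -` (Pi\<^sub>E J B) \<inter> space M)"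
    if [measurable]: "A \<in> sets borel" and B: "\<And>k. k \<in> J \<Longrightarrow> B k \<in> sets borel" for A B
  proof -
    define E where "E = (\<lambda>\<omega>. \<lambda>k\<in>J. W k \<omega>) -` (Pi\<^sub>E J B) \<inter> space M"
    have E[measurable]: "E \<in> sets M" unfolding E_def
      using J B by (intro measurable_sets[OF W']) (auto intro!: sets_PiM_I_finite)
    have indE: "(\<Prod>k\<in>J. indicator (B k) (W k \<omega>)) = (indicator E \<omega> :: complex)" if "\<omega> \<in> space M" for \<omega>
      using J that by (auto simp: E_def indicator_def PiE_iff prod_zero_iff)
    \<comment> \<open>For \<open>L = J\<close> no frequency is left in \<open>step\<close>, and the
      product of indicators is that of \<open>E\<close>. Read with \<open>E\<close> fixed and
      \<open>s\<close> varying, it says that the centred indicator of \<open>E\<close> is a weight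
      with vanishing transform against \<open>Z\<close>.\<close>
    have char0: "(CLINT \<omega>|M. iexp (s * Z \<omega>) * complex_of_real (indicator E \<omega> - prob E)) = 0" for s
    proof -
      have "(CLINT \<omega>|M. (iexp (s * Z \<omega>) - c s) * indicator E \<omega>) = 0"
        using step[of J B s "\<lambda>_. 0"] J B indE
        by (simp cong: Bochner_Integration.integral_cong)
      moreover have "integrable M (\<lambda>\<omega>. iexp (s * Z \<omega>) * indicator E \<omega>)"
        by (rule integrable_const_bound[of _ 1]) (auto simp: indicator_def)
      moreover have "integrable M (indicator E :: 'a \<Rightarrow> complex)"
        by (rule integrable_const_bound[of _ 1]) (auto simp: indicator_def)
      moreover have "expectation (indicator E :: 'a \<Rightarrow> complex) = prob E"
      proof -
        have "(indicator E :: 'a \<Rightarrow> complex) = (\<lambda>\<omega>. complex_of_real (indicator E \<omega>))"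
          by (auto simp: indicator_def fun_eq_iff)
        then show ?thesis by simp
      qed
      ultimately have "(CLINT \<omega>|M. iexp (s * Z \<omega>) * indicator E \<omega>) = c s * prob E"
        by (simp add: left_diff_distrib)
      moreover have "(CLINT \<omega>|M. iexp (s * Z \<omega>) * complex_of_real (indicator E \<omega> - prob E)) =
          (CLINT \<omega>|M. iexp (s * Z \<omega>) * indicator E \<omega> - iexp (s * Z \<omega>) * prob E)"
        by (intro Bochner_Integration.integral_cong) (auto simp: indicator_def right_diff_distrib)
      ultimately show ?thesis
        using c_int[of s] \<open>integrable M (\<lambda>\<omega>. iexp (s * Z \<omega>) * indicator E \<omega>)\<close>
        by (simp add: c_def)
    qed
    have "expectation (\<lambda>\<omega>. indicator A (Z \<omega>) * (indicator E \<omega> - prob E)) = 0"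
    proof (rule expectation_indicator_eq_0_of_char_real[OF Z _ _ char0])
      show "\<bar>indicator E \<omega> - prob E\<bar> \<le> 1" for \<omega>
        by (cases "\<omega> \<in> E") (simp_all add: abs_le_iff add_increasing order_trans[OF prob_le_1])
    qed auto
    also have "expectation (\<lambda>\<omega>. indicator A (Z \<omega>) * (indicator E \<omega> - prob E)) =
       expectation (\<lambda>\<omega>. indicator (Z -` A \<inter> E) \<omega> - prob E * indicator (Z -` A \<inter> space M) \<omega>)"
      using sets.sets_into_space[OF E]
      by (intro Bochner_Integration.integral_cong) (auto simp: indicator_def)
    also have "\<dots> = prob (Z -` A \<inter> E) - prob E * prob (Z -` A \<inter> space M)"
    proof -
      have "Z -` A \<inter> E = (Z -` A \<inter> space M) \<inter> E" using sets.sets_into_space[OF E] by auto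
      then have [measurable]: "Z -` A \<inter> E \<in> sets M" by auto
      have i: "integrable M (indicat_real (Z -` A \<inter> E))" "integrable M (indicat_real (Z -` A \<inter> space M))"
        by (rule integrable_real_indicator; simp add: less_top[symmetric])+
      have "Z -` A \<inter> E \<inter> space M = Z -` A \<inter> E" using sets.sets_into_space[OF E] by auto
      then show ?thesis
        by (subst Bochner_Integration.integral_diff[OF i(1) integrable_mult_right[OF i(2)]]) simp
    qed
    finally show ?thesis unfolding E_def by (simp add: Int_assoc)
  qed

  have all: "prob (Z -` A \<inter> (\<lambda>\<omega>. \<lambda>k\<in>J. W k \<omega>) -` S \<inter> space M) =
      prob (Z -` A \<inter> space M) * prob ((\<lambda>\<omega>. \<lambda>k\<in>J. W k \<omega>) -` S \<inter> space M)"
    if A: "A \<in> sets borel" and S: "S \<in> sets (Pi\<^sub>M J (\<lambda>_. borel :: real measure))" for A S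
  proof -
    define a where "a = prob (Z -` A \<inter> space M)"
    define V where "V = (\<lambda>\<omega>. \<lambda>k\<in>J. W k \<omega>)"
    have mW: "V \<in> measurable M (Pi\<^sub>M J (\<lambda>_. borel))" unfolding V_def by (rule W')
    \<comment> \<open>For fixed \<open>A\<close> the two sides of the claim are finite measures in
      \<open>S\<close>. By \<open>box\<close> they agree on measurable boxes, a generator stable
      under intersection, and therefore everywhere.\<close>
    define N1 where "N1 = distr (density M (indicator (Z -` A \<inter> space M))) (Pi\<^sub>M J (\<lambda>_. borel)) V"
    define N2 where "N2 = scale_measure (ennreal a) (distr M (Pi\<^sub>M J (\<lambda>_. borel)) V)"
    have ZA: "Z -` A \<inter> space M \<in> sets M" using A by auto
    have N1: "emeasure N1 S = prob (Z -` A \<inter> V -` S \<inter> space M)" if "S \<in> sets (Pi\<^sub>M J (\<lambda>_. borel))" for S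
    proof -
      have "emeasure N1 S = emeasure (density M (indicator (Z -` A \<inter> space M))) (V -` S \<inter> space M)"
        unfolding N1_def using that mW by (subst emeasure_distr) auto
      also have "\<dots> = emeasure M ((Z -` A \<inter> space M) \<inter> (V -` S \<inter> space M))"
        using measurable_sets[OF mW that] ZA
        by (subst emeasure_density) (auto simp: indicator_inter_arith[symmetric] )
      also have "(Z -` A \<inter> space M) \<inter> (V -` S \<inter> space M) = Z -` A \<inter> V -` S \<inter> space M" by auto
      finally show ?thesis by (simp add: emeasure_eq_measure)
    qed
    have N2: "emeasure N2 S = ennreal (a * prob (V -` S \<inter> space M))" if "S \<in> sets (Pi\<^sub>M J (\<lambda>_. borel))" for S
      unfolding N2_def using that mW
      by (simp add: emeasure_distr emeasure_eq_measure ennreal_mult a_def)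
    have "N1 = N2"
    proof (rule measure_eqI_PiM_finite[OF J])
      show "sets N1 = sets (Pi\<^sub>M J (\<lambda>_. borel :: real measure))" by (simp add: N1_def)
      show "sets N2 = sets (Pi\<^sub>M J (\<lambda>_. borel :: real measure))" by (simp add: N2_def)
      show "emeasure N1 (Pi\<^sub>E J B) = emeasure N2 (Pi\<^sub>E J B)"
        if "\<And>i. i \<in> J \<Longrightarrow> B i \<in> sets (borel :: real measure)" for B
      proof -
        have "Pi\<^sub>E J B \<in> sets (Pi\<^sub>M J (\<lambda>_. borel :: real measure))"
          using that J by (intro sets_PiM_I_finite) auto
        then show ?thesis using N1 N2 box[OF A that] by (simp add: a_def V_def)
      qed
      \<comment> \<open>The measures are finite, so the whole space, as a constant sequence, serves
        as the exhausting sequence.\<close>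
      show "range (\<lambda>_::nat. \<Pi>\<^sub>E k\<in>J. (UNIV :: real set)) \<subseteq> prod_algebra J (\<lambda>_. borel)"
        using J by (auto intro!: prod_algebraI_finite)
      show "(\<Union>i::nat. (\<Pi>\<^sub>E k\<in>J. (UNIV :: real set))) = space (Pi\<^sub>M J (\<lambda>_. borel))"
        by (simp add: space_PiM)
      show "emeasure N1 (\<Pi>\<^sub>E k\<in>J. UNIV) \<noteq> \<infinity>"
        using J by (subst N1) (auto intro!: sets_PiM_I_finite)
    qed
    then have "emeasure N1 S = emeasure N2 S" by simp
    then show ?thesis using N1[OF S] N2[OF S] by (simp add: a_def V_def)
  qed
  show ?thesis
  proof (rule pair_measure_eqI[symmetric])
    show "sigma_finite_measure (distr M borel Z)" "sigma_finite_measure (distr M (Pi\<^sub>M J (\<lambda>_. borel)) (\<lambda>\<omega>. \<lambda>k\<in>J. W k \<omega>))"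
      by (intro prob_space_imp_sigma_finite prob_space_distr; simp)+
    fix A S assume A: "A \<in> sets (distr M borel Z)"
      and S: "S \<in> sets (distr M (Pi\<^sub>M J (\<lambda>_. borel)) (\<lambda>\<omega>. \<lambda>k\<in>J. W k \<omega>))"
    have "(\<lambda>\<omega>. (Z \<omega>, \<lambda>k\<in>J. W k \<omega>)) -` (A \<times> S) \<inter> space M =
        Z -` A \<inter> (\<lambda>\<omega>. \<lambda>k\<in>J. W k \<omega>) -` S \<inter> space M" by auto
    then show "emeasure (distr M borel Z) A * emeasure (distr M (Pi\<^sub>M J (\<lambda>_. borel)) (\<lambda>\<omega>. \<lambda>k\<in>J. W k \<omega>)) S =
        emeasure (distr M (borel \<Otimes>\<^sub>M Pi\<^sub>M J (\<lambda>_. borel)) (\<lambda>\<omega>. (Z \<omega>, \<lambda>k\<in>J. W k \<omega>))) (A \<times> S)"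
      using A S all[of A S] by (simp add: emeasure_distr emeasure_eq_measure ennreal_mult)
  qed simp
qed

section \<open>Shifting a normal variable\<close>

text \<open>The exponential is the likelihood ratio of mean \<open>t\<close> against mean 0,
  obtained by expanding the square. It is the one-dimensional Cameron-Martin factor and the origin
  of the exponent used in all tilts below.\<close>

lemma normal_density_shift:
  assumes "\<sigma> > 0"
  shows "normal_density 0 \<sigma> (z - t) = exp (t * z / \<sigma>\<^sup>2 - t\<^sup>2 / (2 * \<sigma>\<^sup>2)) * normal_density 0 \<sigma> z"
proof -
  have "- (z - t)\<^sup>2 / (2 * \<sigma>\<^sup>2) = (t * z / \<sigma>\<^sup>2 - t\<^sup>2 / (2 * \<sigma>\<^sup>2)) + (- z\<^sup>2 / (2 * \<sigma>\<^sup>2))"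
    using assms by (simp add: power2_eq_square field_simps)
  then show ?thesis
    by (simp add: normal_density_def exp_add[symmetric])
qed

lemma (in prob_space) char_centred_normal:
  assumes Y: "distributed M lborel Y (normal_density 0 \<sigma>)" and \<sigma>: "\<sigma> > 0"
  shows "(CLINT \<omega>|M. iexp (Y \<omega>)) = of_real (exp (- \<sigma>\<^sup>2 / 2))"
proof -
  have D: "distributed M lborel (\<lambda>\<omega>. Y \<omega> / \<sigma>) std_normal_density"
    using Y normal_standard_normal_convert[OF \<sigma>, of Y 0] by simp
  have [measurable]: "Y \<in> borel_measurable M" using distributed_measurable[OF Y] by simp
  have "of_real (exp (- \<sigma>\<^sup>2 / 2)) = char std_normal_distribution \<sigma>"
    by (simp add: char_std_normal_distribution)
  also have "\<dots> = char (distr M lborel (\<lambda>\<omega>. Y \<omega> / \<sigma>)) \<sigma>"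
    using distributed_distr_eq_density[OF D] by simp
  also have "\<dots> = (CLINT \<omega>|M. iexp (Y \<omega>))"
    unfolding char_def using \<sigma> by (subst integral_distr) auto
  finally show ?thesis by simp
qed

text \<open>Completing the square turns the weighted density into a constant multiple of the normal
  density with mean \<open>c * \<sigma>\<^sup>2\<close>.\<close>

lemma (in prob_space) integrable_exp_normal:
  assumes Z: "distributed M lborel Z (normal_density 0 \<sigma>)" and \<sigma>: "\<sigma> > 0"
  shows "integrable M (\<lambda>\<omega>. exp (c * Z \<omega>))"
proof -
  have eq: "normal_density 0 \<sigma> x * exp (c * x) = exp (c\<^sup>2 * \<sigma>\<^sup>2 / 2) * normal_density (c * \<sigma>\<^sup>2) \<sigma> x" for x
  proof -
    have "- x\<^sup>2 / (2 * \<sigma>\<^sup>2) + c * x = c\<^sup>2 * \<sigma>\<^sup>2 / 2 + (- (x - c * \<sigma>\<^sup>2)\<^sup>2 / (2 * \<sigma>\<^sup>2))"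
      using \<sigma> by (simp add: power2_eq_square field_simps)
    then show ?thesis by (simp add: normal_density_def exp_add[symmetric] mult.commute)
  qed
  have "integrable lborel (\<lambda>x. normal_density 0 \<sigma> x * exp (c * x))"
    unfolding eq using \<sigma> by simp
  then show ?thesis
    by (subst distributed_integrable[OF Z, symmetric]) auto
qed

text \<open>The domination needed to differentiate the tilted expectation at 0. The bound is linear
  in \<bar>t\<bar>, so division by \<open>t\<close> leaves an integrable function that does not
  depend on \<open>t\<close>.\<close>

lemma (in prob_space) normal_tilt_bound:
  assumes Z: "distributed M lborel Z (normal_density 0 \<sigma>)" and \<sigma>: "\<sigma> > 0"
    and [measurable]: "S \<in> borel_measurable M" and S: "integrable M (\<lambda>\<omega>. (S \<omega>)\<^sup>2)"
  obtains w where "integrable M w"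
    and "\<And>t \<omega>. \<bar>t\<bar> \<le> 1 \<Longrightarrow> \<bar>S \<omega> * (exp (t * Z \<omega> / \<sigma>\<^sup>2 - t\<^sup>2 / (2 * \<sigma>\<^sup>2)) - 1)\<bar> \<le> \<bar>t\<bar> * w \<omega>"
proof -
  \<comment> \<open>For \<bar>t\<bar> \<le> 1 the exponent is at most \<bar>t\<bar> times
    \<open>r\<close> in absolute value.\<close>
  define r where "r \<omega> = (\<bar>Z \<omega>\<bar> + 1) / \<sigma>\<^sup>2" for \<omega>
  \<comment> \<open>The 4 arises from two doublings: absorbing the linear factor \<open>r\<close>
    into \<open>exp r\<close> gives \<open>exp (2 * r)\<close>, and separating this from
    \<open>S\<close> by the inequality between a product and the sum of squares gives
    \<open>exp (4 * r)\<close>. The sum of two exponentials replaces that of \<bar>Z\<bar>, so that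
    \<open>integrable_exp_normal\<close> applies.\<close>
  define w where "w \<omega> = (S \<omega>)\<^sup>2 + exp (4 / \<sigma>\<^sup>2) * (exp (4 / \<sigma>\<^sup>2 * Z \<omega>) + exp (- 4 / \<sigma>\<^sup>2 * Z \<omega>))" for \<omega>
  show thesis
  proof
    show "integrable M w" unfolding w_def
      by (intro Bochner_Integration.integrable_add integrable_mult_right S integrable_exp_normal[OF Z \<sigma>])
    fix t :: real and \<omega> assume t: "\<bar>t\<bar> \<le> 1"
    define v where "v = t * Z \<omega> / \<sigma>\<^sup>2 - t\<^sup>2 / (2 * \<sigma>\<^sup>2)"
    have r0: "0 \<le> r \<omega>" by (simp add: r_def)
    have "\<bar>v\<bar> \<le> \<bar>t * Z \<omega> / \<sigma>\<^sup>2\<bar> + \<bar>t\<^sup>2 / (2 * \<sigma>\<^sup>2)\<bar>"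
      unfolding v_def by (rule abs_triangle_ineq4)
    also have "\<dots> = \<bar>t\<bar> * ((\<bar>Z \<omega>\<bar> + \<bar>t\<bar> / 2) / \<sigma>\<^sup>2)"
      using \<sigma> by (simp add: abs_mult field_simps power2_eq_square)
    also have "\<dots> \<le> \<bar>t\<bar> * r \<omega>"
      unfolding r_def using t by (intro mult_left_mono divide_right_mono) auto
    finally have v: "\<bar>v\<bar> \<le> \<bar>t\<bar> * r \<omega>" .
    also have "\<dots> \<le> r \<omega>" using t r0 by (simp add: mult_left_le_one_le)
    finally have v2: "\<bar>v\<bar> \<le> r \<omega>" .
    have r_exp: "r \<omega> \<le> exp (r \<omega>)" using exp_ge_add_one_self[of "r \<omega>"] by linarith
    have "\<bar>exp v - 1\<bar> \<le> \<bar>v\<bar> * exp \<bar>v\<bar>"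
    proof (cases "v \<ge> 0")
      case True
      have "1 - v \<le> exp (- v)" using exp_ge_add_one_self[of "- v"] by simp
      then have "(1 - v) * exp v \<le> exp (- v) * exp v" by (intro mult_right_mono) auto
      then have "exp v - 1 \<le> v * exp v" by (simp add: exp_minus algebra_simps)
      then show ?thesis using True by simp
    next
      case False
      have "exp v \<le> 1" using False by simp
      then have "\<bar>exp v - 1\<bar> \<le> \<bar>v\<bar>" using False exp_ge_add_one_self[of v] by linarith
      also have "\<dots> \<le> \<bar>v\<bar> * exp \<bar>v\<bar>" by (simp add: mult_le_cancel_left1)
      finally show ?thesis .
    qed
    also have "\<dots> \<le> (\<bar>t\<bar> * r \<omega>) * exp (r \<omega>)"
      using v v2 r0 by (intro mult_mono) auto
    also have "\<dots> \<le> \<bar>t\<bar> * (exp (r \<omega>) * exp (r \<omega>))"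
      using r_exp unfolding mult.assoc
      by (intro mult_left_mono mult_right_mono) auto
    finally have e: "\<bar>exp v - 1\<bar> \<le> \<bar>t\<bar> * exp (2 * r \<omega>)"
      by (simp add: exp_add[symmetric])
    have "\<bar>S \<omega>\<bar> * exp (2 * r \<omega>) \<le> (S \<omega>)\<^sup>2 + exp (4 * r \<omega>)"
    proof -
      have "0 \<le> (\<bar>S \<omega>\<bar> - exp (2 * r \<omega>))\<^sup>2" by simp
      then have "2 * (\<bar>S \<omega>\<bar> * exp (2 * r \<omega>)) \<le> (S \<omega>)\<^sup>2 + (exp (2 * r \<omega>))\<^sup>2"
        by (simp add: power2_diff)
      moreover have "(exp (2 * r \<omega>))\<^sup>2 = exp (4 * r \<omega>)"
        by (simp add: exp_double[symmetric])
      ultimately show ?thesis by (smt (verit) mult_nonneg_nonneg abs_ge_zero exp_ge_zero)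
    qed
    also have "exp (4 * r \<omega>) = exp (4 / \<sigma>\<^sup>2) * exp (4 / \<sigma>\<^sup>2 * \<bar>Z \<omega>\<bar>)"
      by (simp add: exp_add[symmetric] r_def add_divide_distrib distrib_left)
    also have "exp (4 / \<sigma>\<^sup>2 * \<bar>Z \<omega>\<bar>) \<le> exp (4 / \<sigma>\<^sup>2 * Z \<omega>) + exp (- 4 / \<sigma>\<^sup>2 * Z \<omega>)"
      by (cases "Z \<omega> \<ge> 0") auto
    finally have "\<bar>S \<omega>\<bar> * exp (2 * r \<omega>) \<le> w \<omega>" by (simp add: w_def)
    have "\<bar>S \<omega> * (exp v - 1)\<bar> \<le> \<bar>S \<omega>\<bar> * (\<bar>t\<bar> * exp (2 * r \<omega>))"
      unfolding abs_mult using e by (intro mult_left_mono) auto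
    also have "\<dots> \<le> \<bar>t\<bar> * w \<omega>"
      using mult_left_mono[OF \<open>\<bar>S \<omega>\<bar> * exp (2 * r \<omega>) \<le> w \<omega>\<close>, of "\<bar>t\<bar>"] by (simp add: mult_ac)
    finally show "\<bar>S \<omega> * (exp (t * Z \<omega> / \<sigma>\<^sup>2 - t\<^sup>2 / (2 * \<sigma>\<^sup>2)) - 1)\<bar> \<le> \<bar>t\<bar> * w \<omega>"
      by (simp add: v_def)
  qed
qed

text \<open>Differentiation under the expectation at 0, where the exponent has derivative
  \<open>Z \<omega> / \<sigma>\<^sup>2\<close> and its quadratic term contributes nothing. It is
  phrased along sequences to suit dominated convergence, with \<bar>t k\<bar> \<le> 1 to match the
  range of the bound.\<close>

lemma (in prob_space) normal_tilt_derivative: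
  assumes Z: "distributed M lborel Z (normal_density 0 \<sigma>)" and \<sigma>: "\<sigma> > 0"
    and [measurable]: "S \<in> borel_measurable M" and S: "integrable M (\<lambda>\<omega>. (S \<omega>)\<^sup>2)"
    and t: "\<And>k. t k \<noteq> 0" "\<And>k. \<bar>t k\<bar> \<le> 1" "t \<longlonglongrightarrow> 0"
  shows "(\<lambda>k. expectation (\<lambda>\<omega>. S \<omega> * (exp (t k * Z \<omega> / \<sigma>\<^sup>2 - (t k)\<^sup>2 / (2 * \<sigma>\<^sup>2)) - 1)) / t k)
    \<longlonglongrightarrow> expectation (\<lambda>\<omega>. S \<omega> * Z \<omega>) / \<sigma>\<^sup>2"
proof -
  obtain w where w: "integrable M w"
    and wb: "\<And>t \<omega>. \<bar>t\<bar> \<le> 1 \<Longrightarrow> \<bar>S \<omega> * (exp (t * Z \<omega> / \<sigma>\<^sup>2 - t\<^sup>2 / (2 * \<sigma>\<^sup>2)) - 1)\<bar> \<le> \<bar>t\<bar> * w \<omega>"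
    using normal_tilt_bound[OF Z \<sigma> assms(3) S] by blast
  have [measurable]: "Z \<in> borel_measurable M" using distributed_measurable[OF Z] by simp
  have "(\<lambda>k. expectation (\<lambda>\<omega>. S \<omega> * (exp (t k * Z \<omega> / \<sigma>\<^sup>2 - (t k)\<^sup>2 / (2 * \<sigma>\<^sup>2)) - 1) / t k))
    \<longlonglongrightarrow> expectation (\<lambda>\<omega>. S \<omega> * (Z \<omega> / \<sigma>\<^sup>2))"
  proof (rule integral_dominated_convergence[where w = w])
    show "AE \<omega> in M. (\<lambda>k. S \<omega> * (exp (t k * Z \<omega> / \<sigma>\<^sup>2 - (t k)\<^sup>2 / (2 * \<sigma>\<^sup>2)) - 1) / t k)
        \<longlonglongrightarrow> S \<omega> * (Z \<omega> / \<sigma>\<^sup>2)"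
    proof (rule AE_I2)
      fix \<omega>
      have "((\<lambda>t. exp (t * Z \<omega> / \<sigma>\<^sup>2 - t\<^sup>2 / (2 * \<sigma>\<^sup>2))) has_field_derivative Z \<omega> / \<sigma>\<^sup>2) (at 0)"
        using \<sigma> by (auto intro!: derivative_eq_intros simp: power2_eq_square)
      then have *: "((\<lambda>t. (exp (t * Z \<omega> / \<sigma>\<^sup>2 - t\<^sup>2 / (2 * \<sigma>\<^sup>2)) - 1) / t) \<longlongrightarrow> Z \<omega> / \<sigma>\<^sup>2) (at 0)"
        by (simp add: has_field_derivative_iff)
      have "filterlim t (at 0) sequentially"
        using t by (auto simp: filterlim_at)
      from tendsto_mult[OF tendsto_const[of "S \<omega>"] filterlim_compose[OF * this]]
      show "(\<lambda>k. S \<omega> * (exp (t k * Z \<omega> / \<sigma>\<^sup>2 - (t k)\<^sup>2 / (2 * \<sigma>\<^sup>2)) - 1) / t k)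
        \<longlonglongrightarrow> S \<omega> * (Z \<omega> / \<sigma>\<^sup>2)" by simp
    qed
    show "AE \<omega> in M. norm (S \<omega> * (exp (t k * Z \<omega> / \<sigma>\<^sup>2 - (t k)\<^sup>2 / (2 * \<sigma>\<^sup>2)) - 1) / t k) \<le> w \<omega>" for k
      using wb[OF t(2)[of k]] t(1)[of k]
      by (intro AE_I2) (simp add: abs_divide pos_divide_le_eq mult.commute)
  qed (use w in auto)
  then show ?thesis by simp
qed

text \<open>Independence allows \<open>V\<close> to be frozen by Fubini. For each frozen value,
  translation invariance of Lebesgue measure moves the shift from \<open>F\<close> onto the normal
  density, where it becomes the tilt. The two integrability hypotheses justify Fubini on the two
  sides.\<close>

lemma (in prob_space) expectation_normal_shift:
  assumes Z: "distributed M lborel Z (normal_density 0 \<sigma>)" and \<sigma>: "\<sigma> > 0"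
    and V[measurable]: "V \<in> measurable M N"
    and indep: "distr M (borel \<Otimes>\<^sub>M N) (\<lambda>\<omega>. (Z \<omega>, V \<omega>)) = distr M borel Z \<Otimes>\<^sub>M distr M N V"
    and F[measurable]: "case_prod F \<in> borel_measurable (borel \<Otimes>\<^sub>M N)"
    and int_shift: "integrable M (\<lambda>\<omega>. F (Z \<omega> + t) (V \<omega>))"
    and int_tilt: "integrable M (\<lambda>\<omega>. exp (t * Z \<omega> / \<sigma>\<^sup>2 - t\<^sup>2 / (2 * \<sigma>\<^sup>2)) * F (Z \<omega>) (V \<omega>))"
  shows "expectation (\<lambda>\<omega>. F (Z \<omega> + t) (V \<omega>)) =
    expectation (\<lambda>\<omega>. exp (t * Z \<omega> / \<sigma>\<^sup>2 - t\<^sup>2 / (2 * \<sigma>\<^sup>2)) * F (Z \<omega>) (V \<omega>))"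
proof -
  have [measurable]: "Z \<in> borel_measurable M" using distributed_measurable[OF Z] by simp
  let ?PZ = "distr M borel Z" and ?PV = "distr M N V"
  interpret PZ: prob_space ?PZ by (rule prob_space_distr) simp
  interpret PV: prob_space ?PV by (rule prob_space_distr) simp
  interpret pair_sigma_finite ?PZ ?PV ..
  have PZ: "?PZ = density lborel (normal_density 0 \<sigma>)"
  proof -
    have "distr M borel Z = distr M lborel Z" by (rule distr_cong) auto
    then show ?thesis using distributed_distr_eq_density[OF Z] by simp
  qed
  have Fubini: "expectation (\<lambda>\<omega>. H (Z \<omega>) (V \<omega>)) = (\<integral>v. (\<integral>z. H z v \<partial>?PZ) \<partial>?PV)"
    if [measurable]: "case_prod H \<in> borel_measurable (borel \<Otimes>\<^sub>M N)"
      and int: "integrable M (\<lambda>\<omega>. H (Z \<omega>) (V \<omega>))" for H :: "real \<Rightarrow> 'b \<Rightarrow> real"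
  proof -
    have "integrable (?PZ \<Otimes>\<^sub>M ?PV) (case_prod H)"
      using int unfolding indep[symmetric] by (subst integrable_distr_eq) auto
    then have "(\<integral>v. (\<integral>z. H z v \<partial>?PZ) \<partial>?PV) = integral\<^sup>L (?PZ \<Otimes>\<^sub>M ?PV) (case_prod H)"
      by (rule integral_snd)
    also have "\<dots> = expectation (\<lambda>\<omega>. H (Z \<omega>) (V \<omega>))"
      unfolding indep[symmetric] by (subst integral_distr) auto
    finally show ?thesis by simp
  qed
  have "expectation (\<lambda>\<omega>. F (Z \<omega> + t) (V \<omega>)) = (\<integral>v. (\<integral>z. F (z + t) v \<partial>?PZ) \<partial>?PV)"
    by (rule Fubini) (use int_shift in auto)
  also have "\<dots> = (\<integral>v. (\<integral>z. exp (t * z / \<sigma>\<^sup>2 - t\<^sup>2 / (2 * \<sigma>\<^sup>2)) * F z v \<partial>?PZ) \<partial>?PV)"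
  proof (rule Bochner_Integration.integral_cong[OF refl])
    fix v assume "v \<in> space ?PV"
    then have [measurable]: "v \<in> space N" by simp
    have "(\<integral>z. F (z + t) v \<partial>?PZ) = (\<integral>z. normal_density 0 \<sigma> z * F (z + t) v \<partial>lborel)"
      unfolding PZ by (subst integral_density) auto
    also have "\<dots> = (\<integral>z. normal_density 0 \<sigma> (z - t) * F z v \<partial>lborel)"
      by (subst lborel_integral_real_affine[where c = 1 and t = "- t"]) (auto simp: add.commute)
    also have "\<dots> = (\<integral>z. exp (t * z / \<sigma>\<^sup>2 - t\<^sup>2 / (2 * \<sigma>\<^sup>2)) * F z v \<partial>?PZ)"
      unfolding PZ by (subst integral_density) (auto simp: normal_density_shift[OF \<sigma>] mult_ac)
    finally show "(\<integral>z. F (z + t) v \<partial>?PZ) = (\<integral>z. exp (t * z / \<sigma>\<^sup>2 - t\<^sup>2 / (2 * \<sigma>\<^sup>2)) * F z v \<partial>?PZ)" .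
  qed
  also have "\<dots> = expectation (\<lambda>\<omega>. exp (t * Z \<omega> / \<sigma>\<^sup>2 - t\<^sup>2 / (2 * \<sigma>\<^sup>2)) * F (Z \<omega>) (V \<omega>))"
    by (rule Fubini[symmetric]) (use int_tilt in auto)
  finally show ?thesis .
qed

section \<open>Centred Gaussian vectors\<close>

lemma linear_span_base: "i \<in> {1..n} \<Longrightarrow> X i \<in> linear_span n X"
  unfolding linear_span_def
  by (rule CollectI, rule exI[of _ "\<lambda>k. if k = i then 1 else 0"]) (auto simp: fun_eq_iff if_distrib[of "\<lambda>x. x * _"] sum.delta cong: if_cong)

lemma linear_span_zero: "(\<lambda>\<omega>. 0) \<in> linear_span n X"
  unfolding linear_span_def by (rule CollectI, rule exI[of _ "\<lambda>_. 0"]) auto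

lemma linear_span_add:
  assumes "Y \<in> linear_span n X" "Z \<in> linear_span n X"
  shows "(\<lambda>\<omega>. Y \<omega> + Z \<omega>) \<in> linear_span n X"
proof -
  obtain \<alpha> \<beta> where "Y = (\<lambda>\<omega>. \<Sum>i=1..n. \<alpha> i * X i \<omega>)" "Z = (\<lambda>\<omega>. \<Sum>i=1..n. \<beta> i * X i \<omega>)"
    using assms by (auto simp: linear_span_def)
  then have "(\<lambda>\<omega>. Y \<omega> + Z \<omega>) = (\<lambda>\<omega>. \<Sum>i=1..n. (\<alpha> i + \<beta> i) * X i \<omega>)"
    by (simp add: distrib_right sum.distrib)
  then show ?thesis
    unfolding linear_span_def by (intro CollectI exI[of _ "\<lambda>i. \<alpha> i + \<beta> i"]) simp
qed

lemma linear_span_scale: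
  assumes "Y \<in> linear_span n X"
  shows "(\<lambda>\<omega>. c * Y \<omega>) \<in> linear_span n X"
proof -
  obtain \<alpha> where "Y = (\<lambda>\<omega>. \<Sum>i=1..n. \<alpha> i * X i \<omega>)"
    using assms by (auto simp: linear_span_def)
  then have "(\<lambda>\<omega>. c * Y \<omega>) = (\<lambda>\<omega>. \<Sum>i=1..n. (c * \<alpha> i) * X i \<omega>)"
    by (simp add: sum_distrib_left mult.assoc)
  then show ?thesis
    unfolding linear_span_def by (intro CollectI exI[of _ "\<lambda>i. c * \<alpha> i"]) simp
qed

lemma linear_span_diff:
  assumes "Y \<in> linear_span n X" "Z \<in> linear_span n X"
  shows "(\<lambda>\<omega>. Y \<omega> - Z \<omega>) \<in> linear_span n X"
  using linear_span_add[OF assms(1) linear_span_scale[OF assms(2), of "-1"]] by simp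

lemma linear_span_sum:
  assumes "\<And>i. i \<in> A \<Longrightarrow> Y i \<in> linear_span n X"
  shows "(\<lambda>\<omega>. \<Sum>i\<in>A. Y i \<omega>) \<in> linear_span n X"
  using assms
  by (induction A rule: infinite_finite_induct) (auto intro: linear_span_zero linear_span_add)

section \<open>One-dimensional centred Gaussian laws, degenerate ones included\<close>

lemma (in prob_space) gaussian_variable_centred_cases:
  assumes Y: "gaussian_variable M Y" and E0: "expectation Y = 0"
  obtains \<sigma> where "\<sigma> > 0" "distributed M lborel Y (normal_density 0 \<sigma>)"
  | "AE \<omega> in M. Y \<omega> = 0"
proof -
  have [measurable]: "Y \<in> borel_measurable M" using Y by (simp add: gaussian_variable_def)
  consider \<mu> \<sigma> where "\<sigma> > 0" "distributed M lborel Y (normal_density \<mu> \<sigma>)"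
    | c where "AE \<omega> in M. Y \<omega> = c"
    using Y by (auto simp: gaussian_variable_def)
  then show thesis
  proof cases
    case 1
    then have "\<mu> = 0" using E0 normal_distributed_expectation[of \<sigma> Y \<mu>] by simp
    then show thesis using 1 that by blast
  next
    case 2
    then have "expectation Y = expectation (\<lambda>_. c)" by (intro integral_cong_AE) auto
    then have "c = 0" using E0 by (simp add: prob_space)
    then show thesis using 2 that by blast
  qed
qed

text \<open>The second moment takes the place of \<open>\<sigma>\<^sup>2\<close>, so that the normal
  and the degenerate case share one formula for the characteristic function; in the latter both
  sides are 1.\<close>

lemma (in prob_space)
  assumes Y: "gaussian_variable M Y" and E0: "expectation Y = 0"
  shows integrable_square_centred_gaussian: "integrable M (\<lambda>\<omega>. (Y \<omega>)\<^sup>2)"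
    and char_centred_gaussian:
      "(CLINT \<omega>|M. iexp (Y \<omega>)) = of_real (exp (- expectation (\<lambda>\<omega>. (Y \<omega>)\<^sup>2) / 2))"
    and centred_gaussian_distributed: "expectation (\<lambda>\<omega>. (Y \<omega>)\<^sup>2) > 0 \<Longrightarrow>
      distributed M lborel Y (normal_density 0 (sqrt (expectation (\<lambda>\<omega>. (Y \<omega>)\<^sup>2))))"
proof -
  have [measurable]: "Y \<in> borel_measurable M" using Y by (simp add: gaussian_variable_def)
  have "integrable M (\<lambda>\<omega>. (Y \<omega>)\<^sup>2) \<and>
     (CLINT \<omega>|M. iexp (Y \<omega>)) = of_real (exp (- expectation (\<lambda>\<omega>. (Y \<omega>)\<^sup>2) / 2)) \<and>
     (expectation (\<lambda>\<omega>. (Y \<omega>)\<^sup>2) > 0 \<longrightarrow>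
      distributed M lborel Y (normal_density 0 (sqrt (expectation (\<lambda>\<omega>. (Y \<omega>)\<^sup>2)))))"
    using Y E0
  proof (cases rule: gaussian_variable_centred_cases)
    case (1 \<sigma>)
    have var: "expectation (\<lambda>\<omega>. (Y \<omega>)\<^sup>2) = \<sigma>\<^sup>2"
      using normal_distributed_variance[OF 1] E0 by simp
    have "integrable lborel (\<lambda>x. normal_density 0 \<sigma> x * x\<^sup>2)"
      using integrable_normal_moment[OF 1(1), of 0 2] by simp
    then have "integrable M (\<lambda>\<omega>. (Y \<omega>)\<^sup>2)"
      by (subst distributed_integrable[OF 1(2), symmetric]) auto
    then show ?thesis
      using var char_centred_normal[OF 1(2,1)] 1 by simp
  next
    case 2
    have i: "integrable M (\<lambda>\<omega>. (Y \<omega>)\<^sup>2)"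
      by (rule integrable_cong_AE_imp[of _ "\<lambda>_. 0"]) (use 2 in auto)
    have "expectation (\<lambda>\<omega>. (Y \<omega>)\<^sup>2) = expectation (\<lambda>_. 0)"
      by (intro integral_cong_AE) (use 2 in auto)
    moreover have "(CLINT \<omega>|M. iexp (Y \<omega>)) = (CLINT \<omega>|M. 1)"
      by (intro integral_cong_AE) (use 2 in auto)
    ultimately show ?thesis using i by (simp add: prob_space)
  qed
  then show "integrable M (\<lambda>\<omega>. (Y \<omega>)\<^sup>2)"
    "(CLINT \<omega>|M. iexp (Y \<omega>)) = of_real (exp (- expectation (\<lambda>\<omega>. (Y \<omega>)\<^sup>2) / 2))"
    "expectation (\<lambda>\<omega>. (Y \<omega>)\<^sup>2) > 0 \<Longrightarrow>
      distributed M lborel Y (normal_density 0 (sqrt (expectation (\<lambda>\<omega>. (Y \<omega>)\<^sup>2))))"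
    by auto
qed

section \<open>Square-integrable variables\<close>

lemma square_integrable_mult:
  assumes "square_integrable M Y" "square_integrable M Z"
  shows "integrable M (\<lambda>\<omega>. Y \<omega> * Z \<omega>)"
proof (rule Bochner_Integration.integrable_bound)
  show "integrable M (\<lambda>\<omega>. (Y \<omega>)\<^sup>2 + (Z \<omega>)\<^sup>2)"
    using assms by (auto simp: square_integrable_def)
  show "(\<lambda>\<omega>. Y \<omega> * Z \<omega>) \<in> borel_measurable M"
    using assms by (auto simp: square_integrable_def)
  have "\<bar>a * b\<bar> \<le> a\<^sup>2 + b\<^sup>2" for a b :: real
  proof -
    have "0 \<le> (\<bar>a\<bar> - \<bar>b\<bar>)\<^sup>2" by simp
    then have "2 * \<bar>a * b\<bar> \<le> a\<^sup>2 + b\<^sup>2" by (simp add: power2_diff abs_mult)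
    then show ?thesis using abs_ge_zero[of "a * b"] by linarith
  qed
  then show "AE \<omega> in M. norm (Y \<omega> * Z \<omega>) \<le> norm ((Y \<omega>)\<^sup>2 + (Z \<omega>)\<^sup>2)"
    by (intro AE_I2) simp
qed

lemma (in prob_space) square_integrable_integrable:
  "square_integrable M Y \<Longrightarrow> integrable M Y"
  using square_integrable_mult[of M Y "\<lambda>_. 1"] by (simp add: square_integrable_def)

lemma square_integrable_diff:
  assumes "square_integrable M Y" "square_integrable M Z"
  shows "square_integrable M (\<lambda>\<omega>. Y \<omega> - Z \<omega>)"
proof -
  have "(\<lambda>\<omega>. (Y \<omega> - Z \<omega>)\<^sup>2) = (\<lambda>\<omega>. (Y \<omega>)\<^sup>2 + (Z \<omega>)\<^sup>2 - 2 * (Y \<omega> * Z \<omega>))"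
    by (simp add: power2_diff fun_eq_iff)
  then show ?thesis
    using square_integrable_mult[OF assms] assms by (auto simp: square_integrable_def)
qed

lemma square_integrable_Max:
  assumes "finite J" "J \<noteq> {}" "\<And>i. i \<in> J \<Longrightarrow> square_integrable M (X i)"
  shows "square_integrable M (\<lambda>\<omega>. Max ((\<lambda>i. X i \<omega>) ` J))"
  unfolding square_integrable_def
proof
  show meas: "(\<lambda>\<omega>. Max ((\<lambda>i. X i \<omega>) ` J)) \<in> borel_measurable M"
    using assms by (intro borel_measurable_Max) (auto simp: square_integrable_def)
  show "integrable M (\<lambda>\<omega>. (Max ((\<lambda>i. X i \<omega>) ` J))\<^sup>2)"
  proof (rule Bochner_Integration.integrable_bound)
    show "integrable M (\<lambda>\<omega>. \<Sum>i\<in>J. (X i \<omega>)\<^sup>2)"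
      using assms by (intro Bochner_Integration.integrable_sum) (auto simp: square_integrable_def)
    show "AE \<omega> in M. norm ((Max ((\<lambda>i. X i \<omega>) ` J))\<^sup>2) \<le> norm (\<Sum>i\<in>J. (X i \<omega>)\<^sup>2)"
    proof (rule AE_I2)
      fix \<omega>
      have "Max ((\<lambda>i. X i \<omega>) ` J) \<in> (\<lambda>i. X i \<omega>) ` J" using assms by (intro Max_in) auto
      then obtain i where i: "i \<in> J" "Max ((\<lambda>i. X i \<omega>) ` J) = X i \<omega>" by auto
      then have "(X i \<omega>)\<^sup>2 \<le> (\<Sum>i\<in>J. (X i \<omega>)\<^sup>2)"
        using assms by (intro member_le_sum) auto
      then show "norm ((Max ((\<lambda>i. X i \<omega>) ` J))\<^sup>2) \<le> norm (\<Sum>i\<in>J. (X i \<omega>)\<^sup>2)"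
        using i by (simp add: sum_nonneg)
    qed
  qed (use meas in auto)
qed

section \<open>Linear combinations of a centred Gaussian vector\<close>

lemma (in prob_space)
  assumes X: "centred_gaussian_vector M n X" and Y: "Y \<in> linear_span n X"
  shows linear_span_gaussian: "gaussian_variable M Y"
    and linear_span_square_integrable: "square_integrable M Y"
    and linear_span_expectation: "expectation Y = 0"
proof -
  have g: "gaussian_variable M Y" if "Y \<in> linear_span n X" for Y
    using X that by (auto simp: centred_gaussian_vector_def)
  \<comment> \<open>The order matters: integrability of the coordinates makes the expectation
    linear, linearity shows that \<open>Y\<close> is centred, and only then do the moment formulas
    for centred Gaussians apply to \<open>Y\<close>.\<close>
  have sq: "square_integrable M (X i)" if "i \<in> {1..n}" for i
    using integrable_square_centred_gaussian[of "X i"] g[OF linear_span_base[OF that]] X that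
    by (auto simp: centred_gaussian_vector_def square_integrable_def gaussian_variable_def)
  show E: "expectation Y = 0"
  proof -
    obtain \<alpha> where "Y = (\<lambda>\<omega>. \<Sum>i=1..n. \<alpha> i * X i \<omega>)"
      using Y by (auto simp: linear_span_def)
    then show ?thesis
      using X square_integrable_integrable[OF sq]
      by (simp add: centred_gaussian_vector_def)
  qed
  show "gaussian_variable M Y" using g[OF Y] .
  then show "square_integrable M Y"
    using integrable_square_centred_gaussian[OF _ E]
    by (auto simp: square_integrable_def gaussian_variable_def)
qed

text \<open>Every combination of \<open>Z\<close> and the \<open>W k\<close> lies in the span, hence
  is centred Gaussian, and its characteristic function depends on its second moment alone. Zero
  correlation makes the second moments of \<open>s * Z\<close> and of a combination of the
  \<open>W k\<close> add up, so the exponentials multiply.\<close>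

lemma (in prob_space) centred_gaussian_vector_indep:
  assumes X: "centred_gaussian_vector M n X"
    and Z: "Z \<in> linear_span n X" and W: "\<And>k. k \<in> J \<Longrightarrow> W k \<in> linear_span n X"
    and J: "finite J" and uncorr: "\<And>k. k \<in> J \<Longrightarrow> expectation (\<lambda>\<omega>. Z \<omega> * W k \<omega>) = 0"
  shows "distr M (borel \<Otimes>\<^sub>M Pi\<^sub>M J (\<lambda>_. borel)) (\<lambda>\<omega>. (Z \<omega>, \<lambda>k\<in>J. W k \<omega>)) =
    distr M borel Z \<Otimes>\<^sub>M distr M (Pi\<^sub>M J (\<lambda>_. borel)) (\<lambda>\<omega>. \<lambda>k\<in>J. W k \<omega>)"
proof (rule distr_Pair_eq_of_char_factors)
  note sq = linear_span_square_integrable[OF X]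
  show "Z \<in> borel_measurable M" using sq[OF Z] by (simp add: square_integrable_def)
  show "W k \<in> borel_measurable M" if "k \<in> J" for k
    using sq[OF W[OF that]] by (simp add: square_integrable_def)
  fix s :: real and t :: "_ \<Rightarrow> real"
  define T where "T \<omega> = (\<Sum>k\<in>J. t k * W k \<omega>)" for \<omega>
  have T: "T \<in> linear_span n X"
    unfolding T_def[abs_def] by (intro linear_span_sum linear_span_scale W)
  have sZ: "(\<lambda>\<omega>. s * Z \<omega>) \<in> linear_span n X" by (rule linear_span_scale[OF Z])
  have sZT: "(\<lambda>\<omega>. s * Z \<omega> + T \<omega>) \<in> linear_span n X" by (rule linear_span_add[OF sZ T])
  have char: "(CLINT \<omega>|M. iexp (Y \<omega>)) = of_real (exp (- expectation (\<lambda>\<omega>. (Y \<omega>)\<^sup>2) / 2))"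
    if "Y \<in> linear_span n X" for Y
    using char_centred_gaussian[OF linear_span_gaussian[OF X that] linear_span_expectation[OF X that]] .
  have "expectation (\<lambda>\<omega>. Z \<omega> * T \<omega>) = (\<Sum>k\<in>J. t k * expectation (\<lambda>\<omega>. Z \<omega> * W k \<omega>))"
  proof -
    have "(\<lambda>\<omega>. Z \<omega> * T \<omega>) = (\<lambda>\<omega>. \<Sum>k\<in>J. t k * (Z \<omega> * W k \<omega>))"
      by (simp add: T_def sum_distrib_left mult_ac)
    then show ?thesis
      using square_integrable_mult[OF sq[OF Z] sq[OF W]] by (simp add: Bochner_Integration.integral_sum)
  qed
  then have ZT: "expectation (\<lambda>\<omega>. Z \<omega> * T \<omega>) = 0" using uncorr by simp
  have "(\<lambda>\<omega>. (s * Z \<omega> + T \<omega>)\<^sup>2) = (\<lambda>\<omega>. (s * Z \<omega>)\<^sup>2 + (T \<omega>)\<^sup>2 + 2 * s * (Z \<omega> * T \<omega>))"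
    by (auto simp: power2_sum)
  then have "expectation (\<lambda>\<omega>. (s * Z \<omega> + T \<omega>)\<^sup>2) =
      expectation (\<lambda>\<omega>. (s * Z \<omega>)\<^sup>2) + expectation (\<lambda>\<omega>. (T \<omega>)\<^sup>2)"
    using sq[OF sZ] sq[OF T] square_integrable_mult[OF sq[OF Z] sq[OF T]] ZT
    by (simp add: square_integrable_def)
  then have "(CLINT \<omega>|M. iexp (s * Z \<omega> + T \<omega>)) = (CLINT \<omega>|M. iexp (s * Z \<omega>)) * (CLINT \<omega>|M. iexp (T \<omega>))"
    unfolding char[OF sZ] char[OF T] char[OF sZT]
    by (simp add: exp_add[symmetric] of_real_mult[symmetric] add_divide_distrib del: of_real_mult)
  then show "(CLINT \<omega>|M. iexp (s * Z \<omega> + (\<Sum>k\<in>J. t k * W k \<omega>))) =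
      (CLINT \<omega>|M. iexp (s * Z \<omega>)) * (CLINT \<omega>|M. iexp (\<Sum>k\<in>J. t k * W k \<omega>))"
    unfolding T_def .
qed (fact J)

section \<open>The covariance of the maximum with one coordinate\<close>

text \<open>Integration by parts for the maximum: the events \<open>I \<omega> = i\<close> stand for
  its partial derivatives. This is the orthogonality relation that identifies the coefficients of
  the projection.\<close>

lemma (in prob_space) expectation_Max_mult:
  assumes X: "centred_gaussian_vector M n X" and n: "n \<ge> 1" and j: "j \<in> {1..n}"
    and I: "I \<in> measurable M (count_space {1..n})"
    and argmax: "AE \<omega> in M. X (I \<omega>) \<omega> = Max ((\<lambda>i. X i \<omega>) ` {1..n})"
  shows "expectation (\<lambda>\<omega>. Max ((\<lambda>i. X i \<omega>) ` {1..n}) * X j \<omega>) =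
    (\<Sum>i=1..n. prob {\<omega> \<in> space M. I \<omega> = i} * expectation (\<lambda>\<omega>. X i \<omega> * X j \<omega>))"
proof -
  define J where "J = {1..n}"
  have J: "finite J" "J \<noteq> {}" "j \<in> J" using n j by (auto simp: J_def)
  define S where "S \<omega> = Max ((\<lambda>i. X i \<omega>) ` J)" for \<omega>
  have span: "X k \<in> linear_span n X" if "k \<in> J" for k
    using that linear_span_base by (auto simp: J_def)
  note sqX = linear_span_square_integrable[OF X span]
  have measX: "X k \<in> borel_measurable M" if "k \<in> J" for k
    using sqX[OF that] by (simp add: square_integrable_def)
  have sqS: "square_integrable M S"
    unfolding S_def[abs_def] using J sqX by (intro square_integrable_Max)
  then have measS[measurable]: "S \<in> borel_measurable M" and S2: "integrable M (\<lambda>\<omega>. (S \<omega>)\<^sup>2)"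
    by (auto simp: square_integrable_def)
  have intS: "integrable M S" by (rule square_integrable_integrable[OF sqS])
  have [measurable]: "X j \<in> borel_measurable M" by (rule measX[OF J(3)])
  define s where "s = expectation (\<lambda>\<omega>. (X j \<omega>)\<^sup>2)"
  have "expectation (\<lambda>\<omega>. S \<omega> * X j \<omega>) =
    (\<Sum>i\<in>J. prob {\<omega> \<in> space M. I \<omega> = i} * expectation (\<lambda>\<omega>. X i \<omega> * X j \<omega>))"
  proof (cases "s = 0")
    \<comment> \<open>If \<open>X j\<close> has variance 0 there is nothing to regress on, but then
      \<open>X j\<close> vanishes almost surely and both sides are 0.\<close>
    case True
    have "AE \<omega> in M. (X j \<omega>)\<^sup>2 = 0"
      using True sqX[OF J(3)] unfolding s_def
      by (subst (asm) integral_nonneg_eq_0_iff_AE) (auto simp: square_integrable_def)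
    then have Xj0: "AE \<omega> in M. X j \<omega> = 0" by simp
    have "expectation (\<lambda>\<omega>. Y \<omega> * X j \<omega>) = 0" for Y
      by (rule integral_eq_zero_AE) (use Xj0 in auto)
    then show ?thesis by simp
  next
    case False
    have "s \<ge> 0" by (simp add: s_def)
    with False have s: "s > 0" by simp
    define \<sigma> where "\<sigma> = sqrt s"
    have \<sigma>: "\<sigma> > 0" "\<sigma>\<^sup>2 = s" using s by (auto simp: \<sigma>_def)
    have Z: "distributed M lborel (X j) (normal_density 0 \<sigma>)"
      using centred_gaussian_distributed[OF linear_span_gaussian[OF X span[OF J(3)]]
          linear_span_expectation[OF X span[OF J(3)]]] s
      by (simp add: \<sigma>_def s_def)
    \<comment> \<open>The regression coefficient of \<open>X k\<close> on \<open>X j\<close>. In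
      particular \<open>a j\<close> is 1 and the residual \<open>W j\<close> is identically 0, so
      the index \<open>j\<close> can be treated like all others.\<close>
    define a where "a k = expectation (\<lambda>\<omega>. X k \<omega> * X j \<omega>) / s" for k
    define W where "W k \<omega> = X k \<omega> - a k * X j \<omega>" for k \<omega>
    have W: "W k \<in> linear_span n X" if "k \<in> J" for k
      unfolding W_def[abs_def] by (intro linear_span_diff linear_span_scale span that J)
    have measW: "W k \<in> borel_measurable M" if "k \<in> J" for k
      using linear_span_square_integrable[OF X W[OF that]] by (simp add: square_integrable_def)
    have uncorr: "expectation (\<lambda>\<omega>. X j \<omega> * W k \<omega>) = 0" if "k \<in> J" for k
    proof -
      have "(\<lambda>\<omega>. X j \<omega> * W k \<omega>) = (\<lambda>\<omega>. X k \<omega> * X j \<omega> - a k * (X j \<omega>)\<^sup>2)"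
        by (simp add: W_def fun_eq_iff algebra_simps power2_eq_square)
      moreover have "integrable M (\<lambda>\<omega>. X k \<omega> * X j \<omega>)" "integrable M (\<lambda>\<omega>. (X j \<omega>)\<^sup>2)"
        using square_integrable_mult[OF sqX[OF that] sqX[OF J(3)]] sqX[OF J(3)]
        by (auto simp: square_integrable_def)
      ultimately show ?thesis
        using s by (simp add: a_def s_def[symmetric])
    qed
    define V where "V \<omega> = (\<lambda>k\<in>J. W k \<omega>)" for \<omega>
    have V: "V \<in> measurable M (Pi\<^sub>M J (\<lambda>_. borel))"
      unfolding V_def[abs_def] using measW by (intro measurable_restrict) auto
    have indep: "distr M (borel \<Otimes>\<^sub>M Pi\<^sub>M J (\<lambda>_. borel)) (\<lambda>\<omega>. (X j \<omega>, V \<omega>)) =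
        distr M borel (X j) \<Otimes>\<^sub>M distr M (Pi\<^sub>M J (\<lambda>_. borel)) V"
      unfolding V_def[abs_def]
      by (rule centred_gaussian_vector_indep[OF X span[OF J(3)] W J(1) uncorr])
    \<comment> \<open>The maximum rebuilt from the value of \<open>X j\<close> and the residuals;
      moving the first argument by \<open>t\<close> adds \<open>a k * t\<close> to the
      \<open>k\<close>-th coordinate.\<close>
    define F where "F z w = Max ((\<lambda>k. a k * z + w k) ` J)" for z and w :: "nat \<Rightarrow> real"
    have F: "case_prod F \<in> borel_measurable (borel \<Otimes>\<^sub>M Pi\<^sub>M J (\<lambda>_. borel))"
      unfolding F_def[abs_def] case_prod_beta
      using J by (intro borel_measurable_Max) auto
    have F_shift: "F (X j \<omega> + t) (V \<omega>) = Max ((\<lambda>k. X k \<omega> + a k * t) ` J)" for t \<omega>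
      unfolding F_def by (intro arg_cong[where f = Max] image_cong) (auto simp: V_def W_def algebra_simps)
    have F_S: "F (X j \<omega>) (V \<omega>) = S \<omega>" for \<omega>
      using F_shift[of \<omega> 0] by (simp add: S_def)
    define e where "e t \<omega> = exp (t * X j \<omega> / \<sigma>\<^sup>2 - t\<^sup>2 / (2 * \<sigma>\<^sup>2))" for t \<omega>
    have int_e1: "integrable M (\<lambda>\<omega>. S \<omega> * (e t \<omega> - 1))" if "\<bar>t\<bar> \<le> 1" for t
    proof -
      obtain w where w: "integrable M w"
        and wb: "\<And>t \<omega>. \<bar>t\<bar> \<le> 1 \<Longrightarrow> \<bar>S \<omega> * (e t \<omega> - 1)\<bar> \<le> \<bar>t\<bar> * w \<omega>"
        unfolding e_def using normal_tilt_bound[OF Z \<sigma>(1) measS S2] by blast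
      show ?thesis
      proof (rule Bochner_Integration.integrable_bound)
        show "integrable M (\<lambda>\<omega>. \<bar>t\<bar> * w \<omega>)" using w by simp
        show "(\<lambda>\<omega>. S \<omega> * (e t \<omega> - 1)) \<in> borel_measurable M" unfolding e_def by measurable
        show "AE \<omega> in M. norm (S \<omega> * (e t \<omega> - 1)) \<le> norm (\<bar>t\<bar> * w \<omega>)"
          using wb[OF that] by (intro AE_I2) (auto intro: order_trans[OF _ abs_ge_self])
      qed
    qed
    have I_meas: "{\<omega> \<in> space M. I \<omega> = i} \<in> sets M" if "i \<in> J" for i
    proof -
      have "I -` {i} \<inter> space M \<in> sets M" using that by (intro measurable_sets[OF I]) (auto simp: J_def)
      also have "I -` {i} \<inter> space M = {\<omega> \<in> space M. I \<omega> = i}" by auto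
      finally show ?thesis .
    qed
    have I_in: "I \<omega> \<in> J" if "\<omega> \<in> space M" for \<omega>
      using measurable_space[OF I that] by (simp add: J_def)
    have aI_eq: "a (I \<omega>) = (\<Sum>i\<in>J. a i * indicator {\<omega> \<in> space M. I \<omega> = i} \<omega>)" if "\<omega> \<in> space M" for \<omega>
      using that I_in[OF that] J by (simp add: indicator_def if_distrib cong: if_cong)
    have int_ind: "integrable M (indicat_real {\<omega> \<in> space M. I \<omega> = i})" if "i \<in> J" for i
      using I_meas[OF that] by (intro integrable_real_indicator) (auto simp: less_top[symmetric])
    have int_aI: "integrable M (\<lambda>\<omega>. a (I \<omega>))"
      by (subst Bochner_Integration.integrable_cong[OF refl aI_eq])
         (auto intro!: Bochner_Integration.integrable_sum integrable_mult_right int_ind)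
    have E_aI: "expectation (\<lambda>\<omega>. a (I \<omega>)) = (\<Sum>i\<in>J. a i * prob {\<omega> \<in> space M. I \<omega> = i})"
    proof -
      have "expectation (\<lambda>\<omega>. a (I \<omega>)) = expectation (\<lambda>\<omega>. \<Sum>i\<in>J. a i * indicator {\<omega> \<in> space M. I \<omega> = i} \<omega>)"
        by (intro Bochner_Integration.integral_cong aI_eq refl)
      also have "\<dots> = (\<Sum>i\<in>J. expectation (\<lambda>\<omega>. a i * indicator {\<omega> \<in> space M. I \<omega> = i} \<omega>))"
        by (intro Bochner_Integration.integral_sum integrable_mult_right int_ind)
      also have "\<dots> = (\<Sum>i\<in>J. a i * prob {\<omega> \<in> space M. I \<omega> = i})"
        using I_meas by (intro sum.cong refl) (auto intro!: arg_cong[where f = prob])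
      finally show ?thesis .
    qed
    \<comment> \<open>The index that is optimal at \<open>t = 0\<close> remains a competitor in the
      shifted maximum, which gives the lower bound pointwise. \<open>expectation S\<close> is
      subtracted from both sides, so that what remains is the numerator of a difference
      quotient.\<close>
    have ineq: "t * expectation (\<lambda>\<omega>. a (I \<omega>)) \<le> expectation (\<lambda>\<omega>. S \<omega> * (e t \<omega> - 1))"
      if t: "\<bar>t\<bar> \<le> 1" for t
    proof -
      have int_shift: "integrable M (\<lambda>\<omega>. F (X j \<omega> + t) (V \<omega>))"
      proof (rule square_integrable_integrable)
        have "square_integrable M (\<lambda>\<omega>. X k \<omega> - (- a k * t))" if "k \<in> J" for k
          using sqX[OF that] by (intro square_integrable_diff) (auto simp: square_integrable_def)
        then show "square_integrable M (\<lambda>\<omega>. F (X j \<omega> + t) (V \<omega>))"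
          unfolding F_shift using J by (intro square_integrable_Max) auto
      qed
      have eS: "(\<lambda>\<omega>. e t \<omega> * S \<omega>) = (\<lambda>\<omega>. S \<omega> * (e t \<omega> - 1) + S \<omega>)"
        by (simp add: algebra_simps)
      have int_tilt: "integrable M (\<lambda>\<omega>. e t \<omega> * S \<omega>)"
        unfolding eS by (intro Bochner_Integration.integrable_add int_e1 t intS)
      have "expectation S + t * expectation (\<lambda>\<omega>. a (I \<omega>)) = expectation (\<lambda>\<omega>. S \<omega> + t * a (I \<omega>))"
        using intS int_aI by simp
      also have "\<dots> \<le> expectation (\<lambda>\<omega>. F (X j \<omega> + t) (V \<omega>))"
      proof (rule integral_mono_AE)
        show "integrable M (\<lambda>\<omega>. S \<omega> + t * a (I \<omega>))" using intS int_aI by simp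
        show "AE \<omega> in M. S \<omega> + t * a (I \<omega>) \<le> F (X j \<omega> + t) (V \<omega>)"
          using argmax
        proof (rule AE_mp, intro AE_I2 impI)
          fix \<omega> assume \<omega>: "\<omega> \<in> space M" "X (I \<omega>) \<omega> = Max ((\<lambda>i. X i \<omega>) ` {1..n})"
          then have "S \<omega> + t * a (I \<omega>) = X (I \<omega>) \<omega> + a (I \<omega>) * t" by (simp add: S_def J_def)
          also have "\<dots> \<le> Max ((\<lambda>k. X k \<omega> + a k * t) ` J)"
            using I_in[OF \<omega>(1)] J by (intro Max_ge) auto
          finally show "S \<omega> + t * a (I \<omega>) \<le> F (X j \<omega> + t) (V \<omega>)" by (simp add: F_shift)
        qed
      qed (rule int_shift)
      also have "\<dots> = expectation (\<lambda>\<omega>. e t \<omega> * S \<omega>)"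
        using expectation_normal_shift[where F = F and t = t, OF Z \<sigma>(1) V indep F int_shift] int_tilt
        by (simp add: F_S e_def)
      also have "\<dots> = expectation (\<lambda>\<omega>. S \<omega> * (e t \<omega> - 1)) + expectation S"
        unfolding eS by (intro Bochner_Integration.integral_add int_e1 t intS)
      finally show ?thesis by simp
    qed
    have lim: "(\<lambda>k. expectation (\<lambda>\<omega>. S \<omega> * (e (t k) \<omega> - 1)) / t k) \<longlonglongrightarrow> expectation (\<lambda>\<omega>. S \<omega> * X j \<omega>) / s"
      if "\<And>k. t k \<noteq> 0" "\<And>k. \<bar>t k\<bar> \<le> 1" "t \<longlonglongrightarrow> 0" for t
      using normal_tilt_derivative[OF Z \<sigma>(1) measS S2 that] by (simp add: e_def \<sigma>(2))
    \<comment> \<open>\<open>Suc\<close> avoids division by 0 and keeps the values in the range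
      where \<open>ineq\<close> holds.\<close>
    define \<tau> where "\<tau> k = 1 / real (Suc k)" for k
    have \<tau>: "\<tau> k > 0" "\<tau> k \<le> 1" for k by (auto simp: \<tau>_def)
    have \<tau>0: "\<tau> \<longlonglongrightarrow> 0" unfolding \<tau>_def[abs_def] using LIMSEQ_inverse_real_of_nat by (simp add: inverse_eq_divide)
    \<comment> \<open>Dividing \<open>ineq\<close> by t reverses it for t < 0, so the limits from both sides give equality.\<close>
    have "expectation (\<lambda>\<omega>. a (I \<omega>)) \<le> expectation (\<lambda>\<omega>. S \<omega> * X j \<omega>) / s"
    proof (rule LIMSEQ_le_const[OF lim[of \<tau>]])
      show "\<exists>N. \<forall>k\<ge>N. expectation (\<lambda>\<omega>. a (I \<omega>)) \<le> expectation (\<lambda>\<omega>. S \<omega> * (e (\<tau> k) \<omega> - 1)) / \<tau> k"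
        using ineq \<tau> by (intro exI allI impI) (simp add: pos_le_divide_eq mult.commute less_imp_le)
    qed (use \<tau> \<tau>0 in \<open>auto simp: less_imp_neq[symmetric] less_imp_le\<close>)
    moreover have "expectation (\<lambda>\<omega>. S \<omega> * X j \<omega>) / s \<le> expectation (\<lambda>\<omega>. a (I \<omega>))"
    proof (rule LIMSEQ_le_const2[OF lim[of "\<lambda>k. - \<tau> k"]])
      have "expectation (\<lambda>\<omega>. S \<omega> * (e (- \<tau> k) \<omega> - 1)) / (- \<tau> k) \<le> expectation (\<lambda>\<omega>. a (I \<omega>))" for k
        using ineq[of "- \<tau> k"] \<tau>[of k] by (subst neg_divide_le_eq) (auto simp: mult.commute)
      then show "\<exists>N. \<forall>k\<ge>N. expectation (\<lambda>\<omega>. S \<omega> * (e (- \<tau> k) \<omega> - 1)) / (- \<tau> k) \<le> expectation (\<lambda>\<omega>. a (I \<omega>))"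
        by blast
      show "(\<lambda>k. - \<tau> k) \<longlonglongrightarrow> 0" using tendsto_minus[OF \<tau>0] by simp
      show "- \<tau> k \<noteq> 0" "\<bar>- \<tau> k\<bar> \<le> 1" for k using \<tau>[of k] by auto
    qed
    ultimately have "expectation (\<lambda>\<omega>. S \<omega> * X j \<omega>) = s * (\<Sum>i\<in>J. a i * prob {\<omega> \<in> space M. I \<omega> = i})"
      using s E_aI by (simp add: field_simps)
    also have "\<dots> = (\<Sum>i\<in>J. prob {\<omega> \<in> space M. I \<omega> = i} * expectation (\<lambda>\<omega>. X i \<omega> * X j \<omega>))"
      unfolding sum_distrib_left using s by (intro sum.cong) (auto simp: a_def)
    finally show ?thesis .
  qed
  then show ?thesis by (simp add: S_def J_def)
qed

section \<open>Uniqueness of the maximiser, and the projection\<close>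

text \<open>The difference of the two coordinates is a centred Gaussian variable. Either it has a
  density, and then it avoids 0 almost surely, or it is almost surely 0, and then the correlation
  would be 1.\<close>

lemma (in prob_space) centred_gaussian_vector_AE_neq:
  assumes X: "centred_gaussian_vector M n X" and ij: "i \<in> {1..n}" "j \<in> {1..n}"
    and var: "variance (X i) > 0" "variance (X j) > 0"
    and corr: "correlation M (X i) (X j) < 1"
  shows "AE \<omega> in M. X i \<omega> \<noteq> X j \<omega>"
proof -
  define Y where "Y \<omega> = X i \<omega> - X j \<omega>" for \<omega>
  note span = linear_span_base[OF ij(1), of X] linear_span_base[OF ij(2), of X]
  note E0 = linear_span_expectation[OF X span(1)] linear_span_expectation[OF X span(2)]
  note sq = linear_span_square_integrable[OF X span(1)] linear_span_square_integrable[OF X span(2)]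
  have Yspan: "Y \<in> linear_span n X"
    unfolding Y_def[abs_def] by (rule linear_span_diff[OF span])
  show ?thesis
    using linear_span_gaussian[OF X Yspan] linear_span_expectation[OF X Yspan]
  proof (cases rule: gaussian_variable_centred_cases)
    case (1 \<sigma>)
    have "AE \<omega> in M. Y \<omega> \<noteq> 0"
      by (subst distributed_AE2[OF 1(2)]) (use AE_lborel_singleton[of "0::real"] in auto)
    then show ?thesis by (simp add: Y_def)
  next
    case 2
    have [measurable]: "X i \<in> borel_measurable M" "X j \<in> borel_measurable M"
      using sq by (auto simp: square_integrable_def)
    have "expectation (\<lambda>\<omega>. X i \<omega> * X j \<omega>) = expectation (\<lambda>\<omega>. (X i \<omega>)\<^sup>2)"
         "expectation (\<lambda>\<omega>. (X j \<omega>)\<^sup>2) = expectation (\<lambda>\<omega>. (X i \<omega>)\<^sup>2)"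
      by (intro integral_cong_AE; use 2 in \<open>auto simp: Y_def power2_eq_square\<close>)+
    \<comment> \<open>Positive variances matter here: with variance 0 the quotient would be 0 by
      convention, and no contradiction would arise.\<close>
    then have "correlation M (X i) (X j) = 1"
      using var E0 by (simp add: correlation_def covariance_def)
    then show ?thesis using corr by simp
  qed
qed

text \<open>Positivity of the variances is part of the correlation assumption because
  \<open>correlation\<close> is 0 for a null coordinate, so that two null coordinates would pass the
  bound although they tie. It is asked for pairs of distinct indices only, so for
  \<open>n = 1\<close> the single coordinate may be degenerate. The second conjunct provides
  existence of the projection, the last one its uniqueness up to null sets.\<close>

theorem proposition2p1:
  fixes \<Omega> :: "'a measure"
    and n :: nat
    and X :: "nat \<Rightarrow> 'a \<Rightarrow> real"
    and K :: "nat \<Rightarrow> nat \<Rightarrow> real"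
    and M :: "'a \<Rightarrow> real"
    and I :: "'a \<Rightarrow> nat"
  assumes "prob_space \<Omega>"
    and "n \<ge> 1"
    and "centred_gaussian_vector \<Omega> n X"
    and "\<And>i j. i \<in> {1..n} \<Longrightarrow> j \<in> {1..n} \<Longrightarrow>
           K i j = prob_space.expectation \<Omega> (\<lambda>\<omega>. X i \<omega> * X j \<omega>)"
    and "\<And>i j. i \<in> {1..n} \<Longrightarrow> j \<in> {1..n} \<Longrightarrow> i \<noteq> j \<Longrightarrow>
           prob_space.variance \<Omega> (X i) > 0 \<and> prob_space.variance \<Omega> (X j) > 0 \<and>
           correlation \<Omega> (X i) (X j) < 1"
    and "M = (\<lambda>\<omega>. Max ((\<lambda>i. X i \<omega>) ` {1..n}))"
    and "I \<in> measurable \<Omega> (count_space {1..n})"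
    and "AE \<omega> in \<Omega>. X (I \<omega>) \<omega> = M \<omega>"
  shows "(AE \<omega> in \<Omega>. \<exists>!i. i \<in> {1..n} \<and> X i \<omega> = M \<omega>) \<and>
    is_best_linear_approx \<Omega> n X M
      (\<lambda>\<omega>. \<Sum>i=1..n. measure \<Omega> {\<omega>' \<in> space \<Omega>. I \<omega>' = i} * X i \<omega>) \<and>
    (\<forall>Q. is_best_linear_approx \<Omega> n X M Q \<longrightarrow>
      (AE \<omega> in \<Omega>. Q \<omega> = (\<Sum>i=1..n. measure \<Omega> {\<omega>' \<in> space \<Omega>. I \<omega>' = i} * X i \<omega>)) \<and>
      prob_space.variance \<Omega> Q =
        (\<Sum>i=1..n. \<Sum>j=1..n. K i j * measure \<Omega> {\<omega> \<in> space \<Omega>. I \<omega> = i}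
                                       * measure \<Omega> {\<omega> \<in> space \<Omega>. I \<omega> = j}))"
proof -
  interpret prob_space \<Omega> by fact
  note X = assms(3) and K = assms(4) and corr = assms(5) and M = assms(6) and I = assms(7)
  have argmax: "AE \<omega> in \<Omega>. X (I \<omega>) \<omega> = Max ((\<lambda>i. X i \<omega>) ` {1..n})"
    using assms(8) by (simp add: M)
  define p where "p i = prob {\<omega> \<in> space \<Omega>. I \<omega> = i}" for i
  define Q where "Q \<omega> = (\<Sum>i=1..n. p i * X i \<omega>)" for \<omega>
  note span = linear_span_base[where X = X and n = n]
  note sq = linear_span_square_integrable[OF X]
  note E0 = linear_span_expectation[OF X]
  have sqM: "square_integrable \<Omega> M"
    unfolding M using assms(2) sq[OF span] by (intro square_integrable_Max) auto
  have Q: "Q \<in> linear_span n X" by (auto simp: linear_span_def Q_def[abs_def])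
  define N where "N \<omega> = M \<omega> - expectation M - Q \<omega>" for \<omega>
  have "square_integrable \<Omega> (\<lambda>\<omega>. expectation M)" by (simp add: square_integrable_def)
  then have sqN: "square_integrable \<Omega> N"
    unfolding N_def[abs_def] by (intro square_integrable_diff[OF square_integrable_diff[OF sqM] sq[OF Q]])

  have unique: "AE \<omega> in \<Omega>. \<exists>!i. i \<in> {1..n} \<and> X i \<omega> = M \<omega>"
  proof -
    have "AE \<omega> in \<Omega>. \<forall>i\<in>{1..n}. \<forall>j\<in>{1..n}. i \<noteq> j \<longrightarrow> X i \<omega> \<noteq> X j \<omega>"
    proof (intro AE_finite_allI finite_atLeastAtMost)
      fix i j assume "i \<in> {1..n}" "j \<in> {1..n}"
      then show "AE \<omega> in \<Omega>. i \<noteq> j \<longrightarrow> X i \<omega> \<noteq> X j \<omega>"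
        using centred_gaussian_vector_AE_neq[OF X, of i j] corr[of i j] by (cases "i = j") auto
    qed
    then show ?thesis
    proof (rule AE_mp, intro AE_I2 impI)
      fix \<omega> assume neq: "\<forall>i\<in>{1..n}. \<forall>j\<in>{1..n}. i \<noteq> j \<longrightarrow> X i \<omega> \<noteq> X j \<omega>"
      have "M \<omega> \<in> (\<lambda>i. X i \<omega>) ` {1..n}"
        unfolding M using assms(2) by (intro Max_in) auto
      then obtain i where "i \<in> {1..n}" "X i \<omega> = M \<omega>" by auto
      then show "\<exists>!i. i \<in> {1..n} \<and> X i \<omega> = M \<omega>"
        using neq by metis
    qed
  qed

  \<comment> \<open>The constant \<open>expectation M\<close> drops out because \<open>X j\<close>
    is centred, and \<open>expectation_Max_mult\<close> says that \<open>M\<close> and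
    \<open>Q\<close> have the same inner product with \<open>X j\<close>.\<close>
  have orth_X: "expectation (\<lambda>\<omega>. N \<omega> * X j \<omega>) = 0" if j: "j \<in> {1..n}" for j
  proof -
    note mult = square_integrable_mult[OF _ sq[OF span[OF j]]]
    have eq: "(\<lambda>\<omega>. N \<omega> * X j \<omega>) =
        (\<lambda>\<omega>. M \<omega> * X j \<omega> - expectation M * X j \<omega> - (\<Sum>i=1..n. p i * (X i \<omega> * X j \<omega>)))"
      by (simp add: N_def Q_def fun_eq_iff left_diff_distrib sum_distrib_right mult.assoc)
    have i: "integrable \<Omega> (\<lambda>\<omega>. M \<omega> * X j \<omega>)" "integrable \<Omega> (X j)"
        "\<And>i. i \<in> {1..n} \<Longrightarrow> integrable \<Omega> (\<lambda>\<omega>. X i \<omega> * X j \<omega>)"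
      using mult[OF sqM] mult[OF sq[OF span]] square_integrable_integrable[OF sq[OF span[OF j]]] by auto
    have "expectation (\<lambda>\<omega>. N \<omega> * X j \<omega>) =
        expectation (\<lambda>\<omega>. M \<omega> * X j \<omega>) - expectation M * expectation (X j) -
        (\<Sum>i=1..n. p i * expectation (\<lambda>\<omega>. X i \<omega> * X j \<omega>))"
    proof -
      have "integrable \<Omega> (\<lambda>\<omega>. \<Sum>i=1..n. p i * (X i \<omega> * X j \<omega>))"
        by (intro Bochner_Integration.integrable_sum integrable_mult_right i(3))
      moreover have "expectation (\<lambda>\<omega>. \<Sum>i=1..n. p i * (X i \<omega> * X j \<omega>)) =
          (\<Sum>i=1..n. p i * expectation (\<lambda>\<omega>. X i \<omega> * X j \<omega>))"
        by (subst Bochner_Integration.integral_sum) (use i(3) in auto)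
      ultimately show ?thesis unfolding eq using i(1,2) by simp
    qed
    then show ?thesis
      using expectation_Max_mult[OF X assms(2) j I argmax] E0[OF span[OF j]]
      by (simp add: M p_def)
  qed
  have orth: "expectation (\<lambda>\<omega>. N \<omega> * R \<omega>) = 0" if R: "R \<in> linear_span n X" for R
  proof -
    obtain \<alpha> where \<alpha>: "R = (\<lambda>\<omega>. \<Sum>i=1..n. \<alpha> i * X i \<omega>)" using R by (auto simp: linear_span_def)
    have "(\<lambda>\<omega>. N \<omega> * R \<omega>) = (\<lambda>\<omega>. \<Sum>i=1..n. \<alpha> i * (N \<omega> * X i \<omega>))"
      by (simp add: \<alpha> sum_distrib_left mult_ac)
    then show ?thesis
      using square_integrable_mult[OF sqN sq[OF span]] orth_X
      by (simp add: Bochner_Integration.integral_sum)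
  qed
  \<comment> \<open>The excess error of \<open>R\<close> over \<open>Q\<close> is exactly the second
    moment of \<open>Q - R\<close>: its nonnegativity gives optimality of \<open>Q\<close>, and its
    vanishing gives uniqueness.\<close>
  have pythagoras: "expectation (\<lambda>\<omega>. (M \<omega> - expectation M - R \<omega>)\<^sup>2) =
      expectation (\<lambda>\<omega>. (N \<omega>)\<^sup>2) + expectation (\<lambda>\<omega>. (Q \<omega> - R \<omega>)\<^sup>2)"
    if R: "R \<in> linear_span n X" for R
  proof -
    have D: "(\<lambda>\<omega>. Q \<omega> - R \<omega>) \<in> linear_span n X" by (rule linear_span_diff[OF Q R])
    have "(\<lambda>\<omega>. (M \<omega> - expectation M - R \<omega>)\<^sup>2) =
        (\<lambda>\<omega>. (N \<omega>)\<^sup>2 + (Q \<omega> - R \<omega>)\<^sup>2 + 2 * (N \<omega> * (Q \<omega> - R \<omega>)))"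
      by (simp add: N_def fun_eq_iff power2_eq_square algebra_simps)
    then show ?thesis
      using orth[OF D] square_integrable_mult[OF sqN sq[OF D]] sqN sq[OF D]
      by (simp add: square_integrable_def)
  qed
  have best: "is_best_linear_approx \<Omega> n X M Q"
    unfolding is_best_linear_approx_def
  proof (intro conjI ballI sqM sq Q)
    fix R assume R: "R \<in> linear_span n X"
    have "expectation (\<lambda>\<omega>. (Q \<omega> - R \<omega>)\<^sup>2) \<ge> 0" by simp
    then show "expectation (\<lambda>\<omega>. (M \<omega> - expectation M - Q \<omega>)\<^sup>2)
        \<le> expectation (\<lambda>\<omega>. (M \<omega> - expectation M - R \<omega>)\<^sup>2)"
      using pythagoras[OF R] by (simp add: N_def)
  qed

  have varQ: "variance Q = (\<Sum>i=1..n. \<Sum>j=1..n. K i j * p i * p j)"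
  proof -
    have eq: "(\<lambda>\<omega>. (Q \<omega>)\<^sup>2) = (\<lambda>\<omega>. \<Sum>i=1..n. \<Sum>j=1..n. p i * p j * (X i \<omega> * X j \<omega>))"
      by (simp add: Q_def power2_eq_square sum_product mult_ac)
    have i: "integrable \<Omega> (\<lambda>\<omega>. X i \<omega> * X j \<omega>)" if "i \<in> {1..n}" "j \<in> {1..n}" for i j
      by (rule square_integrable_mult[OF sq[OF span[OF that(1)]] sq[OF span[OF that(2)]]])
    have "variance Q = expectation (\<lambda>\<omega>. (Q \<omega>)\<^sup>2)" using E0[OF Q] by simp
    also have "\<dots> = (\<Sum>i=1..n. \<Sum>j=1..n. p i * p j * expectation (\<lambda>\<omega>. X i \<omega> * X j \<omega>))"
      unfolding eq using i
      by (subst Bochner_Integration.integral_sum)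
         (auto intro!: sum.cong Bochner_Integration.integrable_sum simp: Bochner_Integration.integral_sum)
    also have "\<dots> = (\<Sum>i=1..n. \<Sum>j=1..n. K i j * p i * p j)"
      by (intro sum.cong refl) (simp add: K)
    finally show ?thesis .
  qed
  \<comment> \<open>Uniqueness concerns the random variable and not its coefficients, since the
    coordinates may be linearly dependent; hence the argument through the second moment of
    \<open>Q - R\<close>.\<close>
  have best_unique: "(AE \<omega> in \<Omega>. R \<omega> = Q \<omega>) \<and> variance R = (\<Sum>i=1..n. \<Sum>j=1..n. K i j * p i * p j)"
    if "is_best_linear_approx \<Omega> n X M R" for R
  proof -
    have R: "R \<in> linear_span n X"
      and "expectation (\<lambda>\<omega>. (M \<omega> - expectation M - R \<omega>)\<^sup>2)
        \<le> expectation (\<lambda>\<omega>. (M \<omega> - expectation M - Q \<omega>)\<^sup>2)"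
      using that Q by (auto simp: is_best_linear_approx_def)
    then have le: "expectation (\<lambda>\<omega>. (Q \<omega> - R \<omega>)\<^sup>2) \<le> 0"
      using pythagoras[OF R] by (simp add: N_def)
    have D: "integrable \<Omega> (\<lambda>\<omega>. (Q \<omega> - R \<omega>)\<^sup>2)"
      using sq[OF linear_span_diff[OF Q R]] by (simp add: square_integrable_def)
    have "expectation (\<lambda>\<omega>. (Q \<omega> - R \<omega>)\<^sup>2) = 0"
      by (intro antisym le) simp
    then have "AE \<omega> in \<Omega>. (Q \<omega> - R \<omega>)\<^sup>2 = 0"
      using D by (subst (asm) integral_nonneg_eq_0_iff_AE) auto
    then have ae: "AE \<omega> in \<Omega>. R \<omega> = Q \<omega>" by (rule AE_mp) (intro AE_I2, simp)
    have [measurable]: "R \<in> borel_measurable \<Omega>" "Q \<in> borel_measurable \<Omega>"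
      using sq[OF R] sq[OF Q] by (auto simp: square_integrable_def)
    have "expectation (\<lambda>\<omega>. (R \<omega>)\<^sup>2) = expectation (\<lambda>\<omega>. (Q \<omega>)\<^sup>2)"
      by (intro integral_cong_AE) (use ae in auto)
    then have "variance R = variance Q"
      using E0[OF R] E0[OF Q] by simp
    then show ?thesis using ae varQ by simp
  qed
  show ?thesis
    using unique best best_unique unfolding Q_def[abs_def] p_def by blast
qed

end
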